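(* Each of the following statistics on D-permutations exhibits the cyclic sieving phenomenon on $\mathfrak{D}_{2n}$ with respect to involutions having $2^nF_{2n-1}$ fixed points: nrcpeak, nrcval, $\mathrm{nrcpeak}+\mathrm{nrcval}+\mathrm{nrcdrise}+\mathrm{nrcdfall}$ (neither-record-antirecords that are not fixed points), lcrosscpeak, lnestcpeak, ucrosscval, unestcval, lcross, lnest, ucross, unest, crossings $\mathrm{ucross}+\mathrm{lcross}$, nestings $\mathrm{unest}+\mathrm{lnest}$.
   Context: A D-permutation of $[2n]$ is a permutation $\sigma$ of $[2n]$ with $\sigma(2k-1)\ge2k-1$ and $\sigma(2k)\le2k$ for all $k$; $\mathfrak{D}_{2n}$ is their set. $F_{2n-1}$ denotes $a_n$ with $a_0=a_1=1$, $a_n=3a_{n-1}-a_{n-2}$. For $i\in[2n]$: cycle peak if $\sigma^{-1}(i)<i>\sigma(i)$, cycle valley if $\sigma^{-1}(i)>i<\sigma(i)$, cycle double rise if $\sigma^{-1}(i)<i<\sigma(i)$, cycle double fall if $\sigma^{-1}(i)>i>\sigma(i)$. $i$ is a record if $\sigma(j)<\sigma(i)$ for all $j<i$, an antirecord if $\sigma(j)>\sigma(i)$ for all $j>i$; nrcpeak, nrcval, nrcdrise, nrcdfall = numbers of cycle peaks, valleys, double rises, double falls that are neither records nor antirecords. $\mathrm{ucross}(i,\sigma)=\#\{j:j<i<\sigma(j)<\sigma(i)\}$, $\mathrm{unest}(i,\sigma)=\#\{j:j<i<\sigma(i)<\sigma(j)\}$, $\mathrm{lcross}(i,\sigma)=\#\{j:j>i>\sigma(j)>\sigma(i)\}$,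 $\mathrm{lnest}(i,\sigma)=\#\{j:j>i>\sigma(i)>\sigma(j)\}$; ucross, unest, lcross, lnest are sums over all $i$; ucrosscval, unestcval are sums over cycle valleys; lcrosscpeak, lnestcpeak are sums over cycle peaks. Cyclic sieving for involutions: for an involution $\phi$ on a finite set $X$ and polynomial $f$, $(X,\{\mathrm{id},\phi\},f)$ exhibits the CSP iff $f(1)=|X|$ and $f(-1)$ equals the number of fixed points of $\phi$; a statistic exhibits the CSP on $\mathfrak{D}_{2n}$ with respect to involutions having $a_n$ fixed points if for every $n\ge0$ and every involution $\phi$ of $\mathfrak{D}_{2n}$ with exactly $a_n$ fixed points, $(\mathfrak{D}_{2n},\{\mathrm{id},\phi\},\sum_{\sigma\in\mathfrak{D}_{2n}}q^{\mathrm{stat}(\sigma)})$ exhibits the CSP. *)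

theory Defs
  imports "HOL-Combinatorics.Permutations" "HOL-Computational_Algebra.Polynomial"
begin

text \<open>
  Permutations of $[N]$ are functions \<open>\<sigma> :: nat \<Rightarrow> nat\<close> with \<open>\<sigma> permutes {1..N}\<close>, so they are
  the identity outside $[N]$.  Every statistic takes the size $N$ as its first argument; for
  D-permutations $N = 2n$.
\<close>

definition D_perms :: "nat \<Rightarrow> (nat \<Rightarrow> nat) set" where
  "D_perms n = {\<sigma>. \<sigma> permutes {1..2*n} \<and>
     (\<forall>k\<in>{1..n}. \<sigma> (2*k - 1) \<ge> 2*k - 1 \<and> \<sigma> (2*k) \<le> 2*k)}"

text \<open>
  The Fibonacci number $F_{2n-1}$, with $F_{-1} = 1$ at $n = 0$; \<open>fib (2*n - 1)\<close> would give the
  wrong value there because of truncated subtraction.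
\<close>

fun fib_odd :: "nat \<Rightarrow> int" where
  "fib_odd 0 = 1"
| "fib_odd (Suc 0) = 1"
| "fib_odd (Suc (Suc n)) = 3 * fib_odd (Suc n) - fib_odd n"

definition cycle_peaks :: "nat \<Rightarrow> (nat \<Rightarrow> nat) \<Rightarrow> nat set" where
  "cycle_peaks N \<sigma> = {i \<in> {1..N}. inv \<sigma> i < i \<and> i > \<sigma> i}"

definition cycle_valleys :: "nat \<Rightarrow> (nat \<Rightarrow> nat) \<Rightarrow> nat set" where
  "cycle_valleys N \<sigma> = {i \<in> {1..N}. inv \<sigma> i > i \<and> i < \<sigma> i}"

definition cycle_double_rises :: "nat \<Rightarrow> (nat \<Rightarrow> nat) \<Rightarrow> nat set" where
  "cycle_double_rises N \<sigma> = {i \<in> {1..N}. inv \<sigma> i < i \<and> i < \<sigma> i}"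

definition cycle_double_falls :: "nat \<Rightarrow> (nat \<Rightarrow> nat) \<Rightarrow> nat set" where
  "cycle_double_falls N \<sigma> = {i \<in> {1..N}. inv \<sigma> i > i \<and> i > \<sigma> i}"

definition is_record :: "nat \<Rightarrow> (nat \<Rightarrow> nat) \<Rightarrow> nat \<Rightarrow> bool" where
  "is_record N \<sigma> i \<longleftrightarrow> (\<forall>j\<in>{1..N}. j < i \<longrightarrow> \<sigma> j < \<sigma> i)"

definition is_antirecord :: "nat \<Rightarrow> (nat \<Rightarrow> nat) \<Rightarrow> nat \<Rightarrow> bool" where
  "is_antirecord N \<sigma> i \<longleftrightarrow> (\<forall>j\<in>{1..N}. j > i \<longrightarrow> \<sigma> j > \<sigma> i)"

definition neither_rec_antirec :: "nat \<Rightarrow> (nat \<Rightarrow> nat) \<Rightarrow> nat set" where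
  "neither_rec_antirec N \<sigma> = {i \<in> {1..N}. \<not> is_record N \<sigma> i \<and> \<not> is_antirecord N \<sigma> i}"

definition nrcpeak :: "nat \<Rightarrow> (nat \<Rightarrow> nat) \<Rightarrow> nat" where
  "nrcpeak N \<sigma> = card (cycle_peaks N \<sigma> \<inter> neither_rec_antirec N \<sigma>)"

definition nrcval :: "nat \<Rightarrow> (nat \<Rightarrow> nat) \<Rightarrow> nat" where
  "nrcval N \<sigma> = card (cycle_valleys N \<sigma> \<inter> neither_rec_antirec N \<sigma>)"

definition nrcdrise :: "nat \<Rightarrow> (nat \<Rightarrow> nat) \<Rightarrow> nat" where
  "nrcdrise N \<sigma> = card (cycle_double_rises N \<sigma> \<inter> neither_rec_antirec N \<sigma>)"

definition nrcdfall :: "nat \<Rightarrow> (nat \<Rightarrow> nat) \<Rightarrow> nat" where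
  "nrcdfall N \<sigma> = card (cycle_double_falls N \<sigma> \<inter> neither_rec_antirec N \<sigma>)"

definition ucross_at :: "nat \<Rightarrow> nat \<Rightarrow> (nat \<Rightarrow> nat) \<Rightarrow> nat" where
  "ucross_at N i \<sigma> = card {j \<in> {1..N}. j < i \<and> i < \<sigma> j \<and> \<sigma> j < \<sigma> i}"

definition unest_at :: "nat \<Rightarrow> nat \<Rightarrow> (nat \<Rightarrow> nat) \<Rightarrow> nat" where
  "unest_at N i \<sigma> = card {j \<in> {1..N}. j < i \<and> i < \<sigma> i \<and> \<sigma> i < \<sigma> j}"

definition lcross_at :: "nat \<Rightarrow> nat \<Rightarrow> (nat \<Rightarrow> nat) \<Rightarrow> nat" where
  "lcross_at N i \<sigma> = card {j \<in> {1..N}. j > i \<and> i > \<sigma> j \<and> \<sigma> j > \<sigma> i}"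

definition lnest_at :: "nat \<Rightarrow> nat \<Rightarrow> (nat \<Rightarrow> nat) \<Rightarrow> nat" where
  "lnest_at N i \<sigma> = card {j \<in> {1..N}. j > i \<and> i > \<sigma> i \<and> \<sigma> i > \<sigma> j}"

definition ucross :: "nat \<Rightarrow> (nat \<Rightarrow> nat) \<Rightarrow> nat" where
  "ucross N \<sigma> = (\<Sum>i\<in>{1..N}. ucross_at N i \<sigma>)"

definition unest :: "nat \<Rightarrow> (nat \<Rightarrow> nat) \<Rightarrow> nat" where
  "unest N \<sigma> = (\<Sum>i\<in>{1..N}. unest_at N i \<sigma>)"

definition lcross :: "nat \<Rightarrow> (nat \<Rightarrow> nat) \<Rightarrow> nat" where
  "lcross N \<sigma> = (\<Sum>i\<in>{1..N}. lcross_at N i \<sigma>)"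

definition lnest :: "nat \<Rightarrow> (nat \<Rightarrow> nat) \<Rightarrow> nat" where
  "lnest N \<sigma> = (\<Sum>i\<in>{1..N}. lnest_at N i \<sigma>)"

definition ucrosscval :: "nat \<Rightarrow> (nat \<Rightarrow> nat) \<Rightarrow> nat" where
  "ucrosscval N \<sigma> = (\<Sum>i\<in>cycle_valleys N \<sigma>. ucross_at N i \<sigma>)"

definition unestcval :: "nat \<Rightarrow> (nat \<Rightarrow> nat) \<Rightarrow> nat" where
  "unestcval N \<sigma> = (\<Sum>i\<in>cycle_valleys N \<sigma>. unest_at N i \<sigma>)"

definition lcrosscpeak :: "nat \<Rightarrow> (nat \<Rightarrow> nat) \<Rightarrow> nat" where
  "lcrosscpeak N \<sigma> = (\<Sum>i\<in>cycle_peaks N \<sigma>. lcross_at N i \<sigma>)"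

definition lnestcpeak :: "nat \<Rightarrow> (nat \<Rightarrow> nat) \<Rightarrow> nat" where
  "lnestcpeak N \<sigma> = (\<Sum>i\<in>cycle_peaks N \<sigma>. lnest_at N i \<sigma>)"

definition involution_on :: "'a set \<Rightarrow> ('a \<Rightarrow> 'a) \<Rightarrow> bool" where
  "involution_on X \<phi> \<longleftrightarrow> (\<forall>x\<in>X. \<phi> x \<in> X \<and> \<phi> (\<phi> x) = x)"

text \<open>
  Cyclic sieving for the triple $(X, \{\mathrm{id}, \phi\}, f)$, where $\phi$ is an involution of the
  finite set $X$.
\<close>

definition exhibits_CSP :: "'a set \<Rightarrow> ('a \<Rightarrow> 'a) \<Rightarrow> int poly \<Rightarrow> bool" where
  "exhibits_CSP X \<phi> f \<longleftrightarrow>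
     poly f 1 = int (card X) \<and> poly f (-1) = int (card {x \<in> X. \<phi> x = x})"

definition stat_poly :: "'a set \<Rightarrow> ('a \<Rightarrow> nat) \<Rightarrow> int poly" where
  "stat_poly X stat = (\<Sum>x\<in>X. monom 1 (stat x))"

definition stat_exhibits_CSP ::
  "(nat \<Rightarrow> (nat \<Rightarrow> nat) \<Rightarrow> nat) \<Rightarrow> (nat \<Rightarrow> int) \<Rightarrow> bool" where
  "stat_exhibits_CSP stat a \<longleftrightarrow>
     (\<forall>n \<phi>. involution_on (D_perms n) \<phi> \<longrightarrow>
        int (card {\<sigma> \<in> D_perms n. \<phi> \<sigma> = \<sigma>}) = a n \<longrightarrow>
        exhibits_CSP (D_perms n) \<phi> (stat_poly (D_perms n) (stat (2*n))))"

end

theory Submission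
  imports Defs
begin

text \<open>
  Everything reduces to showing that \<open>(-1)^stat\<close> sums to $2^n F_{2n-1}$ over D-permutations.
  Call $\sigma$ lower-thin if no cut is crossed by two lower arcs, i.e. there are no $k < j$ with
  $\sigma(k) < k$ and $\sigma(j) < k$. If $\sigma$ is not lower-thin, take the largest such $k = i$;
  its partner $j = m$ is then unique and $i$ is a cycle peak. Exchanging $\sigma(i)$ and $\sigma(m)$ turns
  the crossing of the two arcs into a nesting or vice versa. By maximality of $i$ it alters no
  other local crossing or nesting number, and it alters neither the upper arcs nor the set of
  cycle peaks, so it reverses the sign of every lower or total statistic. On lower-thin
  permutations all these statistics vanish, and a transfer argument on the number (0 or 1) of
  arcs crossing a cut counts the lower-thin D-permutations. Reverse-complement exchanges upper
  and lower statistics.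
\<close>

section \<open>Lower-thin permutations\<close>

text \<open>The quantifiers carry no size bound: a permutation of \<open>{1..N}\<close> fixes every
  larger point, and fixed points cause no violation. One predicate thus serves closed and open
  objects of every length.\<close>

definition lower_thin :: "(nat \<Rightarrow> nat) \<Rightarrow> bool" where
  "lower_thin \<sigma> \<longleftrightarrow> (\<forall>k j. k < j \<and> \<sigma> k < k \<longrightarrow> k \<le> \<sigma> j)"

text \<open>The D-condition at a single point, so that it can be imposed on prefixes of odd length
  as well.\<close>

definition parity_bound :: "(nat \<Rightarrow> nat) \<Rightarrow> nat \<Rightarrow> bool" where
  "parity_bound \<sigma> k \<longleftrightarrow> (if odd k then k \<le> \<sigma> k else \<sigma> k \<le> k)"

lemma D_perms_iff:
  "\<sigma> \<in> D_perms n \<longleftrightarrow> \<sigma> permutes {1..2*n} \<and> (\<forall>k\<in>{1..2*n}. parity_bound \<sigma> k)"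
proof -
  have "(\<forall>k\<in>{1..n}. \<sigma> (2*k - 1) \<ge> 2*k - 1 \<and> \<sigma> (2*k) \<le> 2*k) \<longleftrightarrow>
        (\<forall>k\<in>{1..2*n}. parity_bound \<sigma> k)" (is "?L \<longleftrightarrow> ?R")
  proof
    assume L: ?L
    show ?R
    proof
      fix k assume k: "k \<in> {1..2*n}"
      show "parity_bound \<sigma> k"
      proof (cases "odd k")
        case True
        then obtain l where "k = 2*l+1" by (elim oddE)
        then show ?thesis using L[rule_format, of "l+1"] k True by (simp add: parity_bound_def)
      next
        case False
        then obtain l where "k = 2*l" by (auto elim: evenE)
        then show ?thesis using L[rule_format, of l] k False by (simp add: parity_bound_def)
      qed
    qed
  next
    assume R: ?R
    show ?L
    proof
      fix k assume k: "k \<in> {1..n}"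
      then have "2*k - 1 \<in> {1..2*n}" "2*k \<in> {1..2*n}" "odd (2*k - 1)" by auto
      then show "\<sigma> (2*k - 1) \<ge> 2*k - 1 \<and> \<sigma> (2*k) \<le> 2*k"
        using R[rule_format, of "2*k-1"] R[rule_format, of "2*k"]
        by (simp add: parity_bound_def)
    qed
  qed
  then show ?thesis by (simp add: D_perms_def)
qed

lemma finite_D_perms: "finite (D_perms n)"
  by (rule finite_subset[OF _ finite_permutations[of "{1..2*n}"]]) (auto simp: D_perms_def)

section \<open>Counting lower-thin D-permutations\<close>

definition thin_closed :: "nat \<Rightarrow> (nat \<Rightarrow> nat) set" where
  "thin_closed N = {\<sigma>. \<sigma> permutes {1..N} \<and> (\<forall>k\<in>{1..N}. parity_bound \<sigma> k) \<and> lower_thin \<sigma>}"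

text \<open>
  An object with one arc crossing the cut after \<open>N\<close> is encoded by closing that arc at the extra
  point \<open>Suc N\<close>, which carries no parity constraint.
\<close>

definition thin_open :: "nat \<Rightarrow> (nat \<Rightarrow> nat) set" where
  "thin_open N = {\<sigma>. \<sigma> permutes {1..Suc N} \<and> \<sigma> (Suc N) \<noteq> Suc N \<and>
     (\<forall>k\<in>{1..N}. parity_bound \<sigma> k) \<and> lower_thin \<sigma>}"

lemma finite_thin_closed: "finite (thin_closed N)"
  by (rule finite_subset[OF _ finite_permutations[of "{1..N}"]]) (auto simp: thin_closed_def)

lemma finite_thin_open: "finite (thin_open N)"
  by (rule finite_subset[OF _ finite_permutations[of "{1..Suc N}"]]) (auto simp: thin_open_def)

lemma permutes_Suc_fixed_iff:
  "\<sigma> permutes {1..Suc N} \<and> \<sigma> (Suc N) = Suc N \<longleftrightarrow> \<sigma> permutes {1..N}"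
proof
  assume *: "\<sigma> permutes {1..Suc N} \<and> \<sigma> (Suc N) = Suc N"
  have "{1..Suc N} - {1..N} = {Suc N}" by auto
  with * show "\<sigma> permutes {1..N}"
    by (intro permutes_superset[of \<sigma> "{1..Suc N}" "{1..N}"]) auto
next
  assume "\<sigma> permutes {1..N}"
  then show "\<sigma> permutes {1..Suc N} \<and> \<sigma> (Suc N) = Suc N"
    using permutes_subset[of \<sigma> "{1..N}" "{1..Suc N}"] by (auto simp: permutes_not_in)
qed

lemma thin_closed_disjoint_open: "thin_closed N \<inter> thin_open N = {}"
  by (auto simp: thin_closed_def thin_open_def permutes_not_in)

lemma permutes_le_iff: "\<sigma> permutes {1..N} \<Longrightarrow> \<sigma> k \<le> N \<longleftrightarrow> k \<le> N"
  using permutes_in_image[of \<sigma> "{1..N}" k] permutes_not_in[of \<sigma> "{1..N}" k]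
  by (cases "k \<in> {1..N}") auto

section \<open>Closed objects, extended by one point\<close>

lemma thin_closed_Suc:
  "\<sigma> \<in> thin_closed (Suc N) \<longleftrightarrow>
     \<sigma> \<in> thin_closed N \<or> \<sigma> \<in> thin_open N \<and> parity_bound \<sigma> (Suc N)"
proof -
  have "\<sigma> \<in> thin_closed (Suc N) \<longleftrightarrow> \<sigma> permutes {1..Suc N} \<and>
      (\<forall>k\<in>{1..N}. parity_bound \<sigma> k) \<and> parity_bound \<sigma> (Suc N) \<and> lower_thin \<sigma>"
    unfolding thin_closed_def by (simp add: atLeastAtMostSuc_conv) blast
  moreover have "parity_bound \<sigma> (Suc N)" if "\<sigma> (Suc N) = Suc N"
    using that by (simp add: parity_bound_def)
  ultimately show ?thesis
    using permutes_Suc_fixed_iff[of \<sigma> N]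
    unfolding thin_open_def thin_closed_def mem_Collect_eq by blast
qed

text \<open>The closing point of an open object emits a lower arc, which only an even point may
  do.\<close>

lemma parity_bound_open:
  assumes "\<sigma> \<in> thin_open N"
  shows "parity_bound \<sigma> (Suc N) \<longleftrightarrow> odd N"
proof -
  have "\<sigma> (Suc N) < Suc N"
    using assms permutes_le_iff[of \<sigma> "Suc N" "Suc N"] by (simp add: thin_open_def)
  then show ?thesis by (simp add: parity_bound_def)
qed

lemma thin_closed_Suc_even: "even N \<Longrightarrow> thin_closed (Suc N) = thin_closed N"
  by (rule set_eqI) (simp add: thin_closed_Suc parity_bound_open cong: conj_cong)

lemma thin_closed_Suc_odd: "odd N \<Longrightarrow> thin_closed (Suc N) = thin_closed N \<union> thin_open N"
  by (rule set_eqI) (simp add: thin_closed_Suc parity_bound_open cong: conj_cong)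

section \<open>Open objects, extended by one point\<close>

lemma permutes_conj_transpose:
  assumes "\<tau> permutes S" "a \<in> S" "b \<in> S"
  shows "transpose a b \<circ> \<tau> \<circ> transpose a b permutes S"
  using assms by (intro permutes_compose permutes_swap_id)

text \<open>Conjugating by the transposition of \<open>Suc N\<close> and \<open>Suc (Suc N)\<close>
  moves the closing point one place to the right and inserts a fixed point in its old place. A fixed
  point obeys either parity bound and violates no thinness condition.\<close>

lemma card_thin_open_fixed:
  "card {\<sigma> \<in> thin_open (Suc N). \<sigma> (Suc N) = Suc N} = card (thin_open N)"
proof -
  define t where "t = transpose (Suc N) (Suc (Suc N))"
  define c where "c \<sigma> = t \<circ> \<sigma> \<circ> t" for \<sigma>
  have tt: "t (t k) = k" for k by (simp add: t_def)
  have t_le: "t k = k" if "k \<le> N" for k using that by (simp add: t_def transpose_def)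
  have t_gt: "t k = k" if "k > Suc (Suc N)" for k using that by (simp add: t_def transpose_def)
  have t1: "t (Suc N) = Suc (Suc N)" and t2: "t (Suc (Suc N)) = Suc N" by (auto simp: t_def)
  have cc: "c (c \<sigma>) = \<sigma>" for \<sigma> by (rule ext) (simp add: c_def tt)
  have to: "c \<tau> \<in> {\<sigma> \<in> thin_open (Suc N). \<sigma> (Suc N) = Suc N}" if \<tau>: "\<tau> \<in> thin_open N" for \<tau>
  proof -
    have p: "\<tau> permutes {1..Suc N}" and nf: "\<tau> (Suc N) \<noteq> Suc N" and par: "\<And>k. 1 \<le> k \<Longrightarrow> k \<le> N \<Longrightarrow> parity_bound \<tau> k"
      and th: "lower_thin \<tau>" using \<tau> by (auto simp: thin_open_def)
    have p': "c \<tau> permutes {1..Suc (Suc N)}"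
      unfolding c_def t_def using permutes_subset[OF p]
      by (intro permutes_conj_transpose) auto
    have le: "\<tau> (Suc N) \<le> N" using permutes_le_iff[OF p, of "Suc N"] nf by simp
    have \<tau>2: "\<tau> (Suc (Suc N)) = Suc (Suc N)" using p by (simp add: permutes_not_in)
    have v1: "c \<tau> (Suc N) = Suc N" by (simp add: c_def t1 t2 \<tau>2)
    have v2: "c \<tau> (Suc (Suc N)) = \<tau> (Suc N)" by (simp add: c_def t2 t_le le)
    have v0: "c \<tau> k = (if \<tau> k = Suc N then Suc (Suc N) else \<tau> k)" if "k \<le> N" for k
    proof -
      have "\<tau> k \<le> Suc N" using permutes_le_iff[OF p, of k] that by simp
      then show ?thesis using that by (auto simp: c_def t_le t1 le_Suc_eq)
    qed
    have v3: "c \<tau> k = k" if "k > Suc (Suc N)" for k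
      using permutes_not_in[OF p'] that by simp
    have "lower_thin (c \<tau>)"
      unfolding lower_thin_def
    proof (intro allI impI)
      fix k j assume kj: "k < j \<and> c \<tau> k < k"
      then have k: "k \<le> N \<or> k = Suc (Suc N)" using v1 v3[of k]
        by (cases "k > Suc (Suc N)") (auto simp: le_Suc_eq not_less)
      consider "j \<le> N" | "j = Suc N" | "j = Suc (Suc N)" | "j > Suc (Suc N)" by linarith
      then show "k \<le> c \<tau> j"
      proof cases
        case 1
        then have "k \<le> \<tau> j" using th kj v0[of k] unfolding lower_thin_def
          by (auto split: if_splits)
        then show ?thesis using 1 v0[of j] by auto
      next
        case 3
        then have "k \<le> \<tau> (Suc N)" using th kj v0[of k] k unfolding lower_thin_def
          by (auto split: if_splits)
        then show ?thesis using 3 v2 by auto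
      qed (use kj v1 v3 in auto)
    qed
    moreover have "parity_bound (c \<tau>) k" if "k \<in> {1..Suc N}" for k
      using that par[of k] v1 v0[of k] by (auto simp: parity_bound_def le_Suc_eq split: if_splits)
    ultimately show ?thesis using p' v1 v2 le by (auto simp: thin_open_def)
  qed
  have ret: "c \<sigma> \<in> thin_open N" if \<sigma>: "\<sigma> \<in> thin_open (Suc N)" "\<sigma> (Suc N) = Suc N" for \<sigma>
  proof -
    have p: "\<sigma> permutes {1..Suc (Suc N)}" and nf: "\<sigma> (Suc (Suc N)) \<noteq> Suc (Suc N)"
      and par: "\<And>k. 1 \<le> k \<Longrightarrow> k \<le> Suc N \<Longrightarrow> parity_bound \<sigma> k"
      and th: "lower_thin \<sigma>" using \<sigma> by (auto simp: thin_open_def)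
    have ne: "\<sigma> k \<noteq> Suc N" if "k \<noteq> Suc N" for k
      using \<sigma>(2) permutes_inj[OF p] that by (metis injD)
    have le: "\<sigma> (Suc (Suc N)) \<le> N"
      using permutes_le_iff[OF p, of "Suc (Suc N)"] nf ne[of "Suc (Suc N)"] by simp
    have p'': "c \<sigma> permutes {1..Suc (Suc N)}"
      unfolding c_def t_def using p by (intro permutes_conj_transpose) auto
    have v2: "c \<sigma> (Suc (Suc N)) = Suc (Suc N)" using \<sigma>(2) by (simp add: c_def t1 t2)
    have p': "c \<sigma> permutes {1..Suc N}" using p'' v2 permutes_Suc_fixed_iff by blast
    have v1: "c \<sigma> (Suc N) = \<sigma> (Suc (Suc N))" by (simp add: c_def t1 t_le le)
    have v0: "c \<sigma> k = (if \<sigma> k = Suc (Suc N) then Suc N else \<sigma> k)" if "k \<le> N" for k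
    proof -
      have "\<sigma> k \<le> Suc (Suc N)" using permutes_le_iff[OF p, of k] that by simp
      then show ?thesis using that ne[of k] by (auto simp: c_def t_le t2 le_Suc_eq)
    qed
    have v3: "c \<sigma> k = k" if "k > Suc N" for k
      using permutes_not_in[OF p'] that by simp
    have "lower_thin (c \<sigma>)"
      unfolding lower_thin_def
    proof (intro allI impI)
      fix k j assume kj: "k < j \<and> c \<sigma> k < k"
      consider "j \<le> N" | "j = Suc N" | "j > Suc N" by linarith
      then show "k \<le> c \<sigma> j"
      proof cases
        case 1
        then have "k \<le> \<sigma> j" using th kj v0[of k] unfolding lower_thin_def
          by (auto split: if_splits)
        then show ?thesis using 1 v0[of j] kj by auto
      next
        case 2
        then have "k \<le> \<sigma> (Suc (Suc N))" using th kj v0[of k] unfolding lower_thin_def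
          by (auto split: if_splits)
        then show ?thesis using 2 v1 by auto
      qed (use kj v3 in auto)
    qed
    moreover have "parity_bound (c \<sigma>) k" if "k \<in> {1..N}" for k
      using that par[of k] v0[of k] by (auto simp: parity_bound_def split: if_splits)
    ultimately show ?thesis using p' v1 le by (auto simp: thin_open_def)
  qed
  have "bij_betw c (thin_open N) {\<sigma> \<in> thin_open (Suc N). \<sigma> (Suc N) = Suc N}"
    by (rule bij_betw_byWitness[where f' = c]) (use to ret cc in auto)
  then show ?thesis by (simp add: bij_betw_same_card)
qed

text \<open>Here \<open>Suc N\<close> is odd and moved, so its arc goes up and must end at the
  closing point \<open>Suc (Suc N)\<close>. Exchanging the values at these two points contracts that
  arc. The result fixes \<open>Suc N\<close> if \<open>Suc N\<close> was a cycle valley, which gives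
  a closed object; it is an open object if \<open>Suc N\<close> was a cycle double rise.\<close>

lemma card_thin_open_moved_even:
  assumes "even N"
  shows "card {\<sigma> \<in> thin_open (Suc N). \<sigma> (Suc N) \<noteq> Suc N} = card (thin_closed N \<union> thin_open N)"
proof -
  define t where "t = transpose (Suc N) (Suc (Suc N))"
  define c where "c \<sigma> = \<sigma> \<circ> t" for \<sigma> :: "nat \<Rightarrow> nat"
  have tt: "t (t k) = k" for k by (simp add: t_def)
  have t_eq: "t k = k" if "k \<noteq> Suc N" "k \<noteq> Suc (Suc N)" for k
    using that by (simp add: t_def transpose_def)
  have t1: "t (Suc N) = Suc (Suc N)" and t2: "t (Suc (Suc N)) = Suc N" by (auto simp: t_def)
  have tp: "t permutes {1..Suc (Suc N)}" unfolding t_def by (intro permutes_swap_id) auto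
  have cc: "c (c \<sigma>) = \<sigma>" for \<sigma> by (rule ext) (simp add: c_def tt)
  have v0: "c \<sigma> k = \<sigma> k" if "k \<noteq> Suc N" "k \<noteq> Suc (Suc N)" for k \<sigma>
    using that by (simp add: c_def t_eq)
  have v1: "c \<sigma> (Suc N) = \<sigma> (Suc (Suc N))" and v2: "c \<sigma> (Suc (Suc N)) = \<sigma> (Suc N)" for \<sigma>
    by (simp_all add: c_def t1 t2)
  have to: "c \<tau> \<in> {\<sigma> \<in> thin_open (Suc N). \<sigma> (Suc N) \<noteq> Suc N}"
    if \<tau>: "\<tau> \<in> thin_closed N \<union> thin_open N" for \<tau>
  proof -
    have p: "\<tau> permutes {1..Suc N}" and par: "\<And>k. 1 \<le> k \<Longrightarrow> k \<le> N \<Longrightarrow> parity_bound \<tau> k"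
      and th: "lower_thin \<tau>" using \<tau> permutes_Suc_fixed_iff[of \<tau> N]
      by (auto simp: thin_open_def thin_closed_def)
    have \<tau>2: "\<tau> (Suc (Suc N)) = Suc (Suc N)" using p by (simp add: permutes_not_in)
    have p': "c \<tau> permutes {1..Suc (Suc N)}"
      unfolding c_def by (intro permutes_compose[OF tp] permutes_subset[OF p]) auto
    have le: "\<tau> (Suc N) \<le> Suc N" using permutes_le_iff[OF p, of "Suc N"] by simp
    have "lower_thin (c \<tau>)"
      unfolding lower_thin_def
    proof (intro allI impI)
      fix k j assume kj: "k < j \<and> c \<tau> k < k"
      have k: "k \<noteq> Suc N" using kj v1[of \<tau>] \<tau>2 by auto
      show "k \<le> c \<tau> j"
      proof (cases "k \<le> N")
        case True
        then have "k \<le> \<tau> j'" if "k < j'" for j'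
          using th kj v0[of k] that unfolding lower_thin_def by auto
        \<comment> \<open>The instance at \<open>Suc N\<close> is for
          \<open>j = Suc (Suc N)\<close>, the position to which the value of \<open>Suc N\<close>
          has moved.\<close>
        from this[of j] this[of "Suc N"] show ?thesis
          using kj True v0[of j \<tau>] v1[of \<tau>] v2[of \<tau>] \<tau>2 by (cases "j = Suc N"; cases "j = Suc (Suc N)") auto
      next
        case False
        then have "j > Suc (Suc N)" using k kj by auto
        then show ?thesis using permutes_not_in[OF p'] kj by simp
      qed
    qed
    moreover have "parity_bound (c \<tau>) k" if "k \<in> {1..Suc N}" for k
      using that par[of k] v1[of \<tau>] \<tau>2 v0[of k \<tau>] assms by (auto simp: parity_bound_def le_Suc_eq)
    ultimately show ?thesis using p' v1[of \<tau>] v2[of \<tau>] \<tau>2 le by (auto simp: thin_open_def)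
  qed
  have ret: "c \<sigma> \<in> thin_closed N \<union> thin_open N"
    if \<sigma>: "\<sigma> \<in> thin_open (Suc N)" "\<sigma> (Suc N) \<noteq> Suc N" for \<sigma>
  proof -
    have p: "\<sigma> permutes {1..Suc (Suc N)}" and par: "\<And>k. 1 \<le> k \<Longrightarrow> k \<le> Suc N \<Longrightarrow> parity_bound \<sigma> k"
      and th: "lower_thin \<sigma>" using \<sigma> by (auto simp: thin_open_def)
    have "Suc N \<le> \<sigma> (Suc N)" using par[of "Suc N"] assms by (auto simp: parity_bound_def)
    then have \<sigma>1: "\<sigma> (Suc N) = Suc (Suc N)"
      using permutes_le_iff[OF p, of "Suc N"] \<sigma>(2) by simp
    have "c \<sigma> permutes {1..Suc (Suc N)}" unfolding c_def by (intro permutes_compose[OF tp] p)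
    then have p': "c \<sigma> permutes {1..Suc N}"
      using permutes_Suc_fixed_iff[of "c \<sigma>" "Suc N"] v2[of \<sigma>] \<sigma>1 by simp
    have "lower_thin (c \<sigma>)"
      unfolding lower_thin_def
    proof (intro allI impI)
      fix k j assume kj: "k < j \<and> c \<sigma> k < k"
      show "k \<le> c \<sigma> j"
      proof (cases "k \<le> N")
        case True
        then have "k \<le> \<sigma> j'" if "k < j'" for j'
          using th kj v0[of k] that unfolding lower_thin_def by auto
        from this[of j] this[of "Suc (Suc N)"] show ?thesis
          using kj True v0[of j \<sigma>] v1[of \<sigma>] v2[of \<sigma>] \<sigma>1 by (cases "j = Suc N"; cases "j = Suc (Suc N)") auto
      next
        case False
        then have "j > Suc N" using kj by auto
        then show ?thesis using permutes_not_in[OF p'] kj by simp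
      qed
    qed
    moreover have "parity_bound (c \<sigma>) k" if "k \<in> {1..N}" for k
      using that par[of k] v0[of k \<sigma>] by (auto simp: parity_bound_def)
    ultimately show ?thesis using p' permutes_Suc_fixed_iff[of "c \<sigma>" N]
      by (auto simp: thin_open_def thin_closed_def)
  qed
  have "bij_betw c (thin_closed N \<union> thin_open N) {\<sigma> \<in> thin_open (Suc N). \<sigma> (Suc N) \<noteq> Suc N}"
    by (rule bij_betw_byWitness[where f' = c]) (use to ret cc in auto)
  then show ?thesis by (simp add: bij_betw_same_card)
qed

text \<open>Here \<open>Suc N\<close> is even and moved, so its arc goes down; thinness then forces
  the lower arc of the closing point to end at \<open>Suc N\<close>, a cycle double fall. Exchanging
  the values \<open>Suc N\<close> and \<open>Suc (Suc N)\<close> contracts that arc and always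
  leaves an open object.\<close>

lemma card_thin_open_moved_odd:
  assumes "odd N"
  shows "card {\<sigma> \<in> thin_open (Suc N). \<sigma> (Suc N) \<noteq> Suc N} = card (thin_open N)"
proof -
  define t where "t = transpose (Suc N) (Suc (Suc N))"
  define c where "c \<sigma> = t \<circ> \<sigma>" for \<sigma> :: "nat \<Rightarrow> nat"
  have tt: "t (t k) = k" for k by (simp add: t_def)
  have t_eq: "t k = k" if "k \<noteq> Suc N" "k \<noteq> Suc (Suc N)" for k
    using that by (simp add: t_def transpose_def)
  have t1: "t (Suc N) = Suc (Suc N)" and t2: "t (Suc (Suc N)) = Suc N" by (auto simp: t_def)
  have tp: "t permutes {1..Suc (Suc N)}" unfolding t_def by (intro permutes_swap_id) auto
  have cc: "c (c \<sigma>) = \<sigma>" for \<sigma> by (rule ext) (simp add: c_def tt)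
  \<comment> \<open>Both exchanged values are at least \<open>Suc N\<close>, so comparisons with a
    bound \<open>k\<close> up to \<open>Suc N\<close> do not change; thinness and the parity bounds
    carry over.\<close>
  have ge: "k \<le> t l \<longleftrightarrow> k \<le> l" if "k \<le> Suc N" for k l
    using that t_eq[of l] t1 t2 by (cases "l = Suc N"; cases "l = Suc (Suc N)") auto
  have to: "c \<tau> \<in> {\<sigma> \<in> thin_open (Suc N). \<sigma> (Suc N) \<noteq> Suc N}" if \<tau>: "\<tau> \<in> thin_open N" for \<tau>
  proof -
    have p: "\<tau> permutes {1..Suc N}" and par: "\<And>k. 1 \<le> k \<Longrightarrow> k \<le> N \<Longrightarrow> parity_bound \<tau> k"
      and nf: "\<tau> (Suc N) \<noteq> Suc N"
      and th: "lower_thin \<tau>" using \<tau> by (auto simp: thin_open_def)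
    have \<tau>2: "\<tau> (Suc (Suc N)) = Suc (Suc N)" using p by (simp add: permutes_not_in)
    have p': "c \<tau> permutes {1..Suc (Suc N)}"
      unfolding c_def by (intro permutes_compose[OF _ tp] permutes_subset[OF p]) auto
    have le: "\<tau> (Suc N) \<le> N" using permutes_le_iff[OF p, of "Suc N"] nf by simp
    have v1: "c \<tau> (Suc N) = \<tau> (Suc N)" using le by (simp add: c_def t_eq)
    have v2: "c \<tau> (Suc (Suc N)) = Suc N" by (simp add: c_def \<tau>2 t2)
    have "lower_thin (c \<tau>)"
      unfolding lower_thin_def
    proof (intro allI impI)
      fix k j assume kj: "k < j \<and> c \<tau> k < k"
      show "k \<le> c \<tau> j"
      proof (cases "k \<le> Suc N")
        case True
        then have "\<tau> k < k" using kj ge[of k "\<tau> k"] by (auto simp: c_def not_le[symmetric])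
        then have "k \<le> \<tau> j" using th kj unfolding lower_thin_def by auto
        then show ?thesis using ge[OF True] by (simp add: c_def)
      next
        case False
        then have "j > Suc (Suc N)" using kj by auto
        then show ?thesis using permutes_not_in[OF p'] kj by simp
      qed
    qed
    moreover have "parity_bound (c \<tau>) k" if "k \<in> {1..Suc N}" for k
    proof (cases "k = Suc N")
      case True
      then show ?thesis using v1 le assms by (simp add: parity_bound_def)
    next
      case False
      then have "k \<le> N" using that by simp
      then show ?thesis using par[of k] ge[of k "\<tau> k"] ge[of "Suc k" "\<tau> k"] that
        by (auto simp: parity_bound_def c_def not_less_eq_eq split: if_splits)
    qed
    ultimately show ?thesis using p' v1 v2 nf by (auto simp: thin_open_def)
  qed
  have ret: "c \<sigma> \<in> thin_open N"
    if \<sigma>: "\<sigma> \<in> thin_open (Suc N)" "\<sigma> (Suc N) \<noteq> Suc N" for \<sigma>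
  proof -
    have p: "\<sigma> permutes {1..Suc (Suc N)}" and par: "\<And>k. 1 \<le> k \<Longrightarrow> k \<le> Suc N \<Longrightarrow> parity_bound \<sigma> k"
      and nf: "\<sigma> (Suc (Suc N)) \<noteq> Suc (Suc N)"
      and th: "lower_thin \<sigma>" using \<sigma> by (auto simp: thin_open_def)
    have "\<sigma> (Suc N) \<le> Suc N" using par[of "Suc N"] assms by (auto simp: parity_bound_def)
    then have \<sigma>1: "\<sigma> (Suc N) \<le> N" using \<sigma>(2) by simp
    \<comment> \<open>Thinness rules out that \<open>Suc N\<close> is a cycle peak.\<close>
    then have "Suc N \<le> \<sigma> (Suc (Suc N))" using th unfolding lower_thin_def by auto
    then have \<sigma>2: "\<sigma> (Suc (Suc N)) = Suc N"
      using permutes_le_iff[OF p, of "Suc (Suc N)"] nf by simp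
    have "c \<sigma> permutes {1..Suc (Suc N)}" unfolding c_def by (intro permutes_compose[OF p tp])
    then have p': "c \<sigma> permutes {1..Suc N}"
      using permutes_Suc_fixed_iff[of "c \<sigma>" "Suc N"] \<sigma>2 by (simp add: c_def t1)
    have v1: "c \<sigma> (Suc N) = \<sigma> (Suc N)" using \<sigma>1 by (simp add: c_def t_eq)
    have "lower_thin (c \<sigma>)"
      unfolding lower_thin_def
    proof (intro allI impI)
      fix k j assume kj: "k < j \<and> c \<sigma> k < k"
      show "k \<le> c \<sigma> j"
      proof (cases "k \<le> Suc N")
        case True
        then have "\<sigma> k < k" using kj ge[of k "\<sigma> k"] by (auto simp: c_def not_le[symmetric])
        then have "k \<le> \<sigma> j" using th kj unfolding lower_thin_def by auto
        then show ?thesis using ge[OF True] by (simp add: c_def)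
      next
        case False
        then have "j > Suc N" using kj by auto
        then show ?thesis using permutes_not_in[OF p'] kj by simp
      qed
    qed
    moreover have "parity_bound (c \<sigma>) k" if "k \<in> {1..N}" for k
      using par[of k] ge[of k "\<sigma> k"] ge[of "Suc k" "\<sigma> k"] that
      by (auto simp: parity_bound_def c_def not_less_eq_eq split: if_splits)
    ultimately show ?thesis using p' v1 \<sigma>1
      by (auto simp: thin_open_def)
  qed
  have "bij_betw c (thin_open N) {\<sigma> \<in> thin_open (Suc N). \<sigma> (Suc N) \<noteq> Suc N}"
    by (rule bij_betw_byWitness[where f' = c]) (use to ret cc in auto)
  then show ?thesis by (simp add: bij_betw_same_card)
qed

section \<open>The transfer recurrence and its solution\<close>

lemma card_filter_split:
  assumes "finite A"
  shows "card A = card {x \<in> A. P x} + card {x \<in> A. \<not> P x}"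
proof -
  have "A = {x \<in> A. P x} \<union> {x \<in> A. \<not> P x}" by blast
  also have "card \<dots> = card {x \<in> A. P x} + card {x \<in> A. \<not> P x}"
    using assms by (intro card_Un_disjoint) auto
  finally show ?thesis .
qed

lemma card_thin_closed_Un_open:
  "card (thin_closed N \<union> thin_open N) = card (thin_closed N) + card (thin_open N)"
  by (intro card_Un_disjoint finite_thin_closed finite_thin_open thin_closed_disjoint_open)

lemma card_thin_open_Suc_even:
  "even N \<Longrightarrow> card (thin_open (Suc N)) = card (thin_closed N) + 2 * card (thin_open N)"
  using card_filter_split[OF finite_thin_open, of "Suc N" "\<lambda>\<sigma>. \<sigma> (Suc N) = Suc N"]
  by (simp add: card_thin_open_fixed card_thin_open_moved_even card_thin_closed_Un_open)

lemma card_thin_open_Suc_odd: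
  "odd N \<Longrightarrow> card (thin_open (Suc N)) = 2 * card (thin_open N)"
  using card_filter_split[OF finite_thin_open, of "Suc N" "\<lambda>\<sigma>. \<sigma> (Suc N) = Suc N"]
  by (simp add: card_thin_open_fixed card_thin_open_moved_odd)

text \<open>An odd point keeps the number of closed objects and replaces the open count by closed
  plus twice open; the even point after it adds open to closed and doubles open.\<close>

lemma card_thin_step:
  shows "card (thin_closed (2 * Suc n)) = 2 * card (thin_closed (2*n)) + 2 * card (thin_open (2*n))"
    and "card (thin_open (2 * Suc n)) = 2 * card (thin_closed (2*n)) + 4 * card (thin_open (2*n))"
proof -
  have "card (thin_closed (2 * Suc n)) = card (thin_closed (Suc (2*n))) + card (thin_open (Suc (2*n)))"
    by (simp add: thin_closed_Suc_odd card_thin_closed_Un_open)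
  then show "card (thin_closed (2 * Suc n)) = 2 * card (thin_closed (2*n)) + 2 * card (thin_open (2*n))"
    by (simp add: thin_closed_Suc_even card_thin_open_Suc_even)
  show "card (thin_open (2 * Suc n)) = 2 * card (thin_closed (2*n)) + 4 * card (thin_open (2*n))"
    by (simp add: card_thin_open_Suc_even card_thin_open_Suc_odd)
qed

lemma thin_closed_0: "thin_closed 0 = {id}"
  by (auto simp: thin_closed_def lower_thin_def)

lemma thin_open_0: "thin_open 0 = {}"
  by (auto simp: thin_open_def)

text \<open>The factor \<open>fib_odd (Suc n) - fib_odd n\<close> is the Fibonacci number of index
  2n. The recurrence couples the two counts, so they are proved by one induction.\<close>

lemma card_thin:
  shows "int (card (thin_closed (2*n))) = 2 ^ n * fib_odd n"
    and "int (card (thin_open (2*n))) = 2 ^ n * (fib_odd (Suc n) - fib_odd n)"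
proof (induction n)
  case 0
  {
    case 1
    show ?case by (simp add: thin_closed_0)
  next
    case 2
    show ?case by (simp add: thin_open_0)
  }
next
  case (Suc n)
  {
    case 1
    show ?case using Suc unfolding card_thin_step by (simp add: algebra_simps)
  next
    case 2
    show ?case using Suc unfolding card_thin_step by (simp add: algebra_simps)
  }
qed

section \<open>Statistics in terms of local crossing and nesting numbers\<close>

text \<open>Pigeonhole: a record at \<open>k\<close> would send \<open>{1..k}\<close> injectively
  into \<open>{1..\<sigma> k}\<close>, which has fewer than \<open>k\<close> elements.\<close>

lemma lower_not_record:
  assumes "\<sigma> permutes {1..N}" "k \<in> {1..N}" "\<sigma> k < k"
  shows "\<not> is_record N \<sigma> k"
proof
  assume "is_record N \<sigma> k"
  then have rec: "\<sigma> j < \<sigma> k" if "j \<in> {1..N}" "j < k" for j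
    using that by (simp add: is_record_def)
  have "\<sigma> ` {1..k} \<subseteq> {1..\<sigma> k}"
  proof (intro image_subsetI)
    fix j assume j: "j \<in> {1..k}"
    then have "j \<in> {1..N}" using assms(2) by auto
    then have "\<sigma> j \<in> {1..N}" using permutes_in_image[OF assms(1)] by blast
    then show "\<sigma> j \<in> {1..\<sigma> k}" using rec[of j] j \<open>j \<in> {1..N}\<close> by (cases "j = k") auto
  qed
  then have "card (\<sigma> ` {1..k}) \<le> \<sigma> k"
    using card_mono[of "{1..\<sigma> k}" "\<sigma> ` {1..k}"] by simp
  moreover have "card (\<sigma> ` {1..k}) = k"
    using card_image[OF inj_on_subset[OF permutes_inj[OF assms(1)]], of "{1..k}"] by simp
  ultimately show False using assms(3) by simp
qed

text \<open>Pigeonhole at the other end: an antirecord at \<open>k\<close> would send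
  \<open>{k..N}\<close> injectively into the smaller set \<open>{\<sigma> k..N}\<close>.\<close>

lemma upper_not_antirecord:
  assumes "\<sigma> permutes {1..N}" "k \<in> {1..N}" "k < \<sigma> k"
  shows "\<not> is_antirecord N \<sigma> k"
proof
  assume "is_antirecord N \<sigma> k"
  then have rec: "\<sigma> k < \<sigma> j" if "j \<in> {1..N}" "k < j" for j
    using that by (simp add: is_antirecord_def)
  have k': "\<sigma> k \<in> {1..N}" using permutes_in_image[OF assms(1)] assms(2) by blast
  have "\<sigma> ` {k..N} \<subseteq> {\<sigma> k..N}"
  proof (intro image_subsetI)
    fix j assume j: "j \<in> {k..N}"
    then have "j \<in> {1..N}" using assms(2) by auto
    then have "\<sigma> j \<in> {1..N}" using permutes_in_image[OF assms(1)] by blast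
    then show "\<sigma> j \<in> {\<sigma> k..N}" using rec[of j] j \<open>j \<in> {1..N}\<close> by (cases "j = k") auto
  qed
  then have "card (\<sigma> ` {k..N}) \<le> Suc N - \<sigma> k"
    using card_mono[of "{\<sigma> k..N}" "\<sigma> ` {k..N}"] by simp
  moreover have "card (\<sigma> ` {k..N}) = Suc N - k"
    using card_image[OF inj_on_subset[OF permutes_inj[OF assms(1)]], of "{k..N}"] by simp
  ultimately show False using assms(2,3) k' by auto
qed

section \<open>Nesting numbers detect points that are neither records nor antirecords\<close>

lemma lnest_at_nonzero_iff:
  "lnest_at N k \<sigma> \<noteq> 0 \<longleftrightarrow> (\<exists>j\<in>{1..N}. j > k \<and> k > \<sigma> k \<and> \<sigma> k > \<sigma> j)"
  by (auto simp: lnest_at_def card_eq_0_iff)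

lemma unest_at_nonzero_iff:
  "unest_at N k \<sigma> \<noteq> 0 \<longleftrightarrow> (\<exists>j\<in>{1..N}. j < k \<and> k < \<sigma> k \<and> \<sigma> k < \<sigma> j)"
  by (auto simp: unest_at_def card_eq_0_iff)

text \<open>By pigeonhole such a point is no record, and what spoils an antirecord is a later
  smaller value, which is exactly what \<open>lnest_at\<close> counts.\<close>

lemma lower_neither_rec_antirec_iff:
  assumes "\<sigma> permutes {1..N}" "k \<in> {1..N}" "\<sigma> k < k"
  shows "k \<in> neither_rec_antirec N \<sigma> \<longleftrightarrow> lnest_at N k \<sigma> \<noteq> 0"
proof -
  have "\<sigma> j \<noteq> \<sigma> k" if "j > k" for j using permutes_inj[OF assms(1)] that by (auto dest: injD)
  then have "\<not> is_antirecord N \<sigma> k \<longleftrightarrow> lnest_at N k \<sigma> \<noteq> 0"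
    unfolding lnest_at_nonzero_iff is_antirecord_def using assms(3) by (meson linorder_cases not_less_iff_gr_or_eq)
  then show ?thesis using lower_not_record[OF assms] assms(2) by (simp add: neither_rec_antirec_def)
qed

lemma upper_neither_rec_antirec_iff:
  assumes "\<sigma> permutes {1..N}" "k \<in> {1..N}" "k < \<sigma> k"
  shows "k \<in> neither_rec_antirec N \<sigma> \<longleftrightarrow> unest_at N k \<sigma> \<noteq> 0"
proof -
  have "\<sigma> j \<noteq> \<sigma> k" if "j < k" for j using permutes_inj[OF assms(1)] that by (auto dest: injD)
  then have "\<not> is_record N \<sigma> k \<longleftrightarrow> unest_at N k \<sigma> \<noteq> 0"
    unfolding unest_at_nonzero_iff is_record_def using assms(3) by (meson linorder_cases not_less_iff_gr_or_eq)
  then show ?thesis using upper_not_antirecord[OF assms] assms(2) by (simp add: neither_rec_antirec_def)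
qed

lemma finite_cycle_peaks [simp]: "finite (cycle_peaks N \<sigma>)"
  by (simp add: cycle_peaks_def)

lemma finite_cycle_valleys [simp]: "finite (cycle_valleys N \<sigma>)"
  by (simp add: cycle_valleys_def)

lemma card_filter_eq_sum:
  "finite A \<Longrightarrow> card {x \<in> A. P x} = (\<Sum>x\<in>A. of_bool (P x))"
  by (simp add: sum.If_cases of_bool_def Int_def)

text \<open>Written with indicators of a local number, the count has the same shape as the crossing
  and nesting sums, so one parity argument serves them all.\<close>

lemma nrcpeak_eq_sum:
  assumes "\<sigma> permutes {1..N}"
  shows "nrcpeak N \<sigma> = (\<Sum>k\<in>cycle_peaks N \<sigma>. of_bool (lnest_at N k \<sigma> \<noteq> 0))"
proof -
  have "cycle_peaks N \<sigma> \<inter> neither_rec_antirec N \<sigma> = {k \<in> cycle_peaks N \<sigma>. lnest_at N k \<sigma> \<noteq> 0}"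
    using lower_neither_rec_antirec_iff[OF assms] by (auto simp: cycle_peaks_def)
  then show ?thesis by (simp only: nrcpeak_def card_filter_eq_sum[OF finite_cycle_peaks])
qed

lemma nrcval_eq_sum:
  assumes "\<sigma> permutes {1..N}"
  shows "nrcval N \<sigma> = (\<Sum>k\<in>cycle_valleys N \<sigma>. of_bool (unest_at N k \<sigma> \<noteq> 0))"
proof -
  have "cycle_valleys N \<sigma> \<inter> neither_rec_antirec N \<sigma> = {k \<in> cycle_valleys N \<sigma>. unest_at N k \<sigma> \<noteq> 0}"
    using upper_neither_rec_antirec_iff[OF assms] by (auto simp: cycle_valleys_def)
  then show ?thesis by (simp only: nrcval_def card_filter_eq_sum[OF finite_cycle_valleys])
qed

lemma inv_fixed_iff: "\<sigma> permutes S \<Longrightarrow> inv \<sigma> k = k \<longleftrightarrow> \<sigma> k = k"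
  by (simp add: permutes_inv_eq)

text \<open>A moved point is not its own preimage, so peaks and double falls exhaust the points with
  a lower arc, and valleys and double rises those with an upper arc. Fixed points have both nesting
  numbers 0.\<close>

lemma nrc_total_eq_sum:
  assumes "\<sigma> permutes {1..N}"
  shows "nrcpeak N \<sigma> + nrcval N \<sigma> + nrcdrise N \<sigma> + nrcdfall N \<sigma> =
    (\<Sum>k\<in>{1..N}. of_bool (unest_at N k \<sigma> \<noteq> 0)) + (\<Sum>k\<in>{1..N}. of_bool (lnest_at N k \<sigma> \<noteq> 0))"
proof -
  let ?R = "neither_rec_antirec N \<sigma>"
  have l: "{k \<in> {1..N}. lnest_at N k \<sigma> \<noteq> 0} = (cycle_peaks N \<sigma> \<inter> ?R) \<union> (cycle_double_falls N \<sigma> \<inter> ?R)"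
  proof (intro set_eqI iffI)
    fix k assume k: "k \<in> {k \<in> {1..N}. lnest_at N k \<sigma> \<noteq> 0}"
    then have "\<sigma> k < k" using lnest_at_nonzero_iff[of N k \<sigma>] by auto
    moreover from this have "inv \<sigma> k \<noteq> k" using inv_fixed_iff[OF assms, of k] by simp
    ultimately show "k \<in> (cycle_peaks N \<sigma> \<inter> ?R) \<union> (cycle_double_falls N \<sigma> \<inter> ?R)"
      using lower_neither_rec_antirec_iff[OF assms, of k] k
      by (auto simp: cycle_peaks_def cycle_double_falls_def)
  qed (use lower_neither_rec_antirec_iff[OF assms] in \<open>auto simp: cycle_peaks_def cycle_double_falls_def\<close>)
  have u: "{k \<in> {1..N}. unest_at N k \<sigma> \<noteq> 0} = (cycle_valleys N \<sigma> \<inter> ?R) \<union> (cycle_double_rises N \<sigma> \<inter> ?R)"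
  proof (intro set_eqI iffI)
    fix k assume k: "k \<in> {k \<in> {1..N}. unest_at N k \<sigma> \<noteq> 0}"
    then have "k < \<sigma> k" using unest_at_nonzero_iff[of N k \<sigma>] by auto
    moreover from this have "inv \<sigma> k \<noteq> k" using inv_fixed_iff[OF assms, of k] by simp
    ultimately show "k \<in> (cycle_valleys N \<sigma> \<inter> ?R) \<union> (cycle_double_rises N \<sigma> \<inter> ?R)"
      using upper_neither_rec_antirec_iff[OF assms, of k] k
      by (auto simp: cycle_valleys_def cycle_double_rises_def)
  qed (use upper_neither_rec_antirec_iff[OF assms] in \<open>auto simp: cycle_valleys_def cycle_double_rises_def\<close>)
  have "card {k \<in> {1..N}. lnest_at N k \<sigma> \<noteq> 0} = nrcpeak N \<sigma> + nrcdfall N \<sigma>"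
    unfolding l nrcpeak_def nrcdfall_def
    by (rule card_Un_disjoint) (auto simp: cycle_peaks_def cycle_double_falls_def)
  moreover have "card {k \<in> {1..N}. unest_at N k \<sigma> \<noteq> 0} = nrcval N \<sigma> + nrcdrise N \<sigma>"
    unfolding u nrcval_def nrcdrise_def
    by (rule card_Un_disjoint) (auto simp: cycle_valleys_def cycle_double_rises_def)
  ultimately show ?thesis by (simp only: card_filter_eq_sum[OF finite_atLeastAtMost])
qed

section \<open>Statistics of lower-thin permutations\<close>

lemma lower_thinD: "lower_thin \<sigma> \<Longrightarrow> k < j \<Longrightarrow> \<sigma> k < k \<Longrightarrow> k \<le> \<sigma> j"
  by (simp add: lower_thin_def)

lemma lower_thin_lcross_at: "lower_thin \<sigma> \<Longrightarrow> lcross_at N k \<sigma> = 0"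
proof -
  assume "lower_thin \<sigma>"
  then have "\<not> (j > k \<and> k > \<sigma> j \<and> \<sigma> j > \<sigma> k)" for j
    using lower_thinD[of \<sigma> k j] by auto
  then have "{j \<in> {1..N}. j > k \<and> k > \<sigma> j \<and> \<sigma> j > \<sigma> k} = {}" by blast
  then show ?thesis by (simp only: lcross_at_def card.empty)
qed

lemma lower_thin_lnest_at: "lower_thin \<sigma> \<Longrightarrow> lnest_at N k \<sigma> = 0"
proof -
  assume "lower_thin \<sigma>"
  then have "\<not> (j > k \<and> k > \<sigma> k \<and> \<sigma> k > \<sigma> j)" for j
    using lower_thinD[of \<sigma> k j] by auto
  then have "{j \<in> {1..N}. j > k \<and> k > \<sigma> k \<and> \<sigma> k > \<sigma> j} = {}" by blast
  then show ?thesis by (simp only: lnest_at_def card.empty)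
qed

text \<open>The positions up to \<open>k\<close> and the positions with value up to \<open>k\<close>
  both number \<open>k\<close>; removing their common part leaves the two sets compared.\<close>

lemma card_up_eq_card_down:
  fixes \<sigma> :: "nat \<Rightarrow> nat"
  assumes "\<sigma> permutes {1..N}" "k \<le> N"
  shows "card {j \<in> {1..N}. j \<le> k \<and> k < \<sigma> j} = card {j \<in> {1..N}. k < j \<and> \<sigma> j \<le> k}"
proof -
  let ?B = "{j \<in> {1..N}. j \<le> k \<and> \<sigma> j \<le> k}"
  have "card ({j \<in> {1..N}. j \<le> k \<and> k < \<sigma> j} \<union> ?B) = card {1..k}"
    by (rule arg_cong[where f = card]) (use assms(2) in auto)
  moreover have "card ({j \<in> {1..N}. k < j \<and> \<sigma> j \<le> k} \<union> ?B) = card {1..k}"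
  proof -
    have "\<sigma> ` ({j \<in> {1..N}. k < j \<and> \<sigma> j \<le> k} \<union> ?B) = {1..k}"
    proof (intro equalityI subsetI)
      fix x assume "x \<in> \<sigma> ` ({j \<in> {1..N}. k < j \<and> \<sigma> j \<le> k} \<union> ?B)"
      then obtain j where "j \<in> {1..N}" "x = \<sigma> j" "\<sigma> j \<le> k" by auto
      then show "x \<in> {1..k}" using permutes_in_image[OF assms(1), of j] by auto
    next
      fix x assume x: "x \<in> {1..k}"
      then have "x \<in> \<sigma> ` {1..N}" using permutes_image[OF assms(1)] assms(2) by auto
      then show "x \<in> \<sigma> ` ({j \<in> {1..N}. k < j \<and> \<sigma> j \<le> k} \<union> ?B)" using x by force
    qed
    then show ?thesis
      using card_image[OF inj_on_subset[OF permutes_inj[OF assms(1)]], of "{j \<in> {1..N}. k < j \<and> \<sigma> j \<le> k} \<union> ?B"]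
      by simp
  qed
  moreover have "card ({j \<in> {1..N}. j \<le> k \<and> k < \<sigma> j} \<union> ?B) = card {j \<in> {1..N}. j \<le> k \<and> k < \<sigma> j} + card ?B"
    by (rule card_Un_disjoint) auto
  moreover have "card ({j \<in> {1..N}. k < j \<and> \<sigma> j \<le> k} \<union> ?B) = card {j \<in> {1..N}. k < j \<and> \<sigma> j \<le> k} + card ?B"
    by (rule card_Un_disjoint) auto
  ultimately show ?thesis by linarith
qed

text \<open>Two upper arcs over the cut after \<open>k\<close> force two lower arcs over it; the one
  from the larger point then passes below the smaller point, contrary to thinness. Hence upper
  statistics also vanish on lower-thin permutations.\<close>

lemma lower_thin_no_two_up:
  assumes "\<sigma> permutes {1..N}" "lower_thin \<sigma>" "j < k" "k < \<sigma> j" "k < \<sigma> k"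
  shows False
proof -
  have kN: "k \<in> {1..N}" using assms(5) permutes_not_in[OF assms(1), of k] by (metis less_irrefl)
  have jN: "j \<in> {1..N}" using assms(3,4) permutes_not_in[OF assms(1), of j] by (metis less_asym)
  have "{j, k} \<subseteq> {j \<in> {1..N}. j \<le> k \<and> k < \<sigma> j}" using assms kN jN by auto
  then have "2 \<le> card {j \<in> {1..N}. j \<le> k \<and> k < \<sigma> j}"
    using card_mono[of "{j \<in> {1..N}. j \<le> k \<and> k < \<sigma> j}" "{j, k}"] assms(3) by simp
  then have "2 \<le> card {j \<in> {1..N}. k < j \<and> \<sigma> j \<le> k}"
    using card_up_eq_card_down[OF assms(1), of k] kN by simp
  then obtain x y where "x \<noteq> y" and x: "k < x" "\<sigma> x \<le> k" and y: "k < y" "\<sigma> y \<le> k"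
    using card_le_Suc0_iff_eq[of "{j \<in> {1..N}. k < j \<and> \<sigma> j \<le> k}"] by fastforce
  then consider "x < y" | "y < x" by linarith
  then show False
  proof cases
    case 1
    then have "x \<le> \<sigma> y" using lower_thinD[OF assms(2), of x y] x by simp
    then show False using x y by simp
  next
    case 2
    then have "y \<le> \<sigma> x" using lower_thinD[OF assms(2), of y x] y by simp
    then show False using x y by simp
  qed
qed

lemma lower_thin_ucross_at:
  assumes "\<sigma> permutes {1..N}" "lower_thin \<sigma>"
  shows "ucross_at N k \<sigma> = 0"
proof -
  have "\<not> (j < k \<and> k < \<sigma> j \<and> \<sigma> j < \<sigma> k)" for j
    using lower_thin_no_two_up[OF assms, of j k] by auto
  then have "{j \<in> {1..N}. j < k \<and> k < \<sigma> j \<and> \<sigma> j < \<sigma> k} = {}" by blast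
  then show ?thesis by (simp only: ucross_at_def card.empty)
qed

lemma lower_thin_unest_at:
  assumes "\<sigma> permutes {1..N}" "lower_thin \<sigma>"
  shows "unest_at N k \<sigma> = 0"
proof -
  have "\<not> (j < k \<and> k < \<sigma> k \<and> \<sigma> k < \<sigma> j)" for j
    using lower_thin_no_two_up[OF assms, of j k] by auto
  then have "{j \<in> {1..N}. j < k \<and> k < \<sigma> k \<and> \<sigma> k < \<sigma> j} = {}" by blast
  then show ?thesis by (simp only: unest_at_def card.empty)
qed

section \<open>The sign-reversing involution\<close>

text \<open>The assumption \<open>last\<close> is thinness beyond \<open>i\<close>, which makes
  \<open>i\<close> the last point of failure. Which of \<open>\<sigma> i\<close> and
  \<open>\<sigma> m\<close> is larger is left open, so crossing and nesting are treated
  together.\<close>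

locale critical_pair =
  fixes N :: nat and \<sigma> :: "nat \<Rightarrow> nat" and i m :: nat
  assumes perm: "\<sigma> permutes {1..N}"
    and i_less_m: "i < m" and lower_i: "\<sigma> i < i" and lower_m: "\<sigma> m < i"
    and last: "\<And>k j. i < k \<Longrightarrow> k < j \<Longrightarrow> \<sigma> k < k \<Longrightarrow> k \<le> \<sigma> j"
begin

abbreviation swapped :: "nat \<Rightarrow> nat" where "swapped \<equiv> \<sigma> \<circ> transpose i m"

lemma i_in: "i \<in> {1..N}"
  using permutes_not_in[OF perm, of i] lower_i by (metis less_irrefl)

lemma m_in: "m \<in> {1..N}"
  using permutes_not_in[OF perm, of m] lower_m i_less_m by (metis less_asym)

text \<open>Of two partners the smaller would emit a lower arc and be passed below by the arc of the
  larger, against thinness beyond \<open>i\<close>.\<close>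

lemma partner_unique:
  assumes "i < j" "\<sigma> j < i"
  shows "j = m"
proof (rule ccontr)
  assume "j \<noteq> m"
  then consider "j < m" | "m < j" by linarith
  then show False
    using last[of j m] last[of m j] assms lower_m i_less_m by cases auto
qed

lemma swapped_i: "swapped i = \<sigma> m" and swapped_m: "swapped m = \<sigma> i"
  and swapped_other: "k \<noteq> i \<Longrightarrow> k \<noteq> m \<Longrightarrow> swapped k = \<sigma> k"
  by (simp_all add: transpose_def)

lemma swapped_permutes: "swapped permutes {1..N}"
  using i_in m_in by (intro permutes_compose[OF _ perm] permutes_swap_id)

text \<open>The same pair stays critical. This makes the exchange an involution and lets every fact
  of the locale be reused for \<open>swapped\<close>.\<close>

lemma swapped_critical_pair: "critical_pair N swapped i m"
proof
  show "swapped permutes {1..N}" by (rule swapped_permutes)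
  show "i < m" by (rule i_less_m)
  show "swapped i < i" "swapped m < i" unfolding swapped_i swapped_m by (rule lower_m lower_i)+
  fix k j assume kj: "i < k" "k < j" "swapped k < k"
  have "\<sigma> k < k" using kj swapped_other[of k] lower_m by (cases "k = m") auto
  then have "k \<le> \<sigma> j" using last kj by blast
  then show "k \<le> swapped j" using kj swapped_other[of j] lower_m by (cases "j = m") auto
qed

lemma swapped_swapped: "swapped \<circ> transpose i m = \<sigma>"
  by (rule ext) simp

section \<open>Lower crossing and nesting numbers under the exchange\<close>

lemma lcross_at_beyond: "i < k \<Longrightarrow> lcross_at N k \<sigma> = 0"
proof -
  assume "i < k"
  then have "\<not> (j > k \<and> k > \<sigma> j \<and> \<sigma> j > \<sigma> k)" for j
    using last[of k j] by auto
  then have "{j \<in> {1..N}. j > k \<and> k > \<sigma> j \<and> \<sigma> j > \<sigma> k} = {}" by blast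
  then show ?thesis by (simp only: lcross_at_def card.empty)
qed

lemma lnest_at_beyond: "i < k \<Longrightarrow> lnest_at N k \<sigma> = 0"
proof -
  assume "i < k"
  then have "\<not> (j > k \<and> k > \<sigma> k \<and> \<sigma> k > \<sigma> j)" for j
    using last[of k j] by auto
  then have "{j \<in> {1..N}. j > k \<and> k > \<sigma> k \<and> \<sigma> k > \<sigma> j} = {}" by blast
  then show ?thesis by (simp only: lnest_at_def card.empty)
qed

text \<open>Both exchanged positions lie to the right of \<open>k\<close>, so the values found there
  are only permuted among themselves.\<close>

lemma card_swapped_before:
  assumes "k < i"
  shows "card {j \<in> {1..N}. j > k \<and> P (swapped j)} = card {j \<in> {1..N}. j > k \<and> P (\<sigma> j)}"
proof -
  have t: "transpose i m j \<in> {1..N}" if "j \<in> {1..N}" for j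
    using that i_in m_in by (simp add: transpose_def)
  have t': "transpose i m j > k" if "j > k" for j
    using that assms i_less_m by (simp add: transpose_def)
  have "bij_betw (transpose i m) {j \<in> {1..N}. j > k \<and> P (swapped j)} {j \<in> {1..N}. j > k \<and> P (\<sigma> j)}"
    by (rule bij_betw_byWitness[where f' = "transpose i m"])
      (use t t' in \<open>simp_all add: image_subset_iff\<close>)
  then show ?thesis by (rule bij_betw_same_card)
qed

lemma lcross_at_swapped:
  assumes "k \<noteq> i"
  shows "lcross_at N k swapped = lcross_at N k \<sigma>"
proof (cases "k < i")
  case True
  then show ?thesis
    using card_swapped_before[of k "\<lambda>v. k > v \<and> v > \<sigma> k"] swapped_other[of k] i_less_m
    by (simp add: lcross_at_def)
next
  case False
  then show ?thesis
    using assms lcross_at_beyond critical_pair.lcross_at_beyond[OF swapped_critical_pair] by simp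
qed

lemma lnest_at_swapped:
  assumes "k \<noteq> i"
  shows "lnest_at N k swapped = lnest_at N k \<sigma>"
proof (cases "k < i")
  case True
  then show ?thesis
    using card_swapped_before[of k "\<lambda>v. k > \<sigma> k \<and> \<sigma> k > v"] swapped_other[of k] i_less_m
    by (simp add: lnest_at_def)
next
  case False
  then show ?thesis
    using assms lnest_at_beyond critical_pair.lnest_at_beyond[OF swapped_critical_pair] by simp
qed

text \<open>Uniqueness of the partner leaves \<open>m\<close> as the only candidate for
  \<open>j\<close>.\<close>

lemma lcross_at_critical: "lcross_at N i \<sigma> = of_bool (\<sigma> i < \<sigma> m)"
proof -
  have "j \<in> {1..N} \<and> j > i \<and> i > \<sigma> j \<and> \<sigma> j > \<sigma> i \<longleftrightarrow> j = m \<and> \<sigma> i < \<sigma> m" for j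
    using partner_unique[of j] m_in i_less_m lower_m by auto
  then show ?thesis unfolding lcross_at_def by (cases "\<sigma> i < \<sigma> m") (simp_all del: atLeastAtMost_iff)
qed

lemma lnest_at_critical: "lnest_at N i \<sigma> = of_bool (\<sigma> m < \<sigma> i)"
proof -
  have "j \<in> {1..N} \<and> j > i \<and> i > \<sigma> i \<and> \<sigma> i > \<sigma> j \<longleftrightarrow> j = m \<and> \<sigma> m < \<sigma> i" for j
    using partner_unique[of j] m_in i_less_m lower_i lower_m by auto
  then show ?thesis unfolding lnest_at_def by (cases "\<sigma> m < \<sigma> i") (simp_all del: atLeastAtMost_iff)
qed

lemma values_differ: "\<sigma> i \<noteq> \<sigma> m"
  using permutes_inj[OF perm] i_less_m by (auto dest: injD)

text \<open>The two arcs cross in exactly one of \<open>\<sigma>\<close> and \<open>swapped\<close>,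
  because the exchange reverses the comparison of the two distinct values.\<close>

lemma lcross_at_critical_sum: "lcross_at N i \<sigma> + lcross_at N i swapped = 1"
  using critical_pair.lcross_at_critical[OF swapped_critical_pair] lcross_at_critical values_differ
  unfolding swapped_i swapped_m by (auto simp: of_bool_def)

lemma lnest_at_critical_sum: "lnest_at N i \<sigma> + lnest_at N i swapped = 1"
  using critical_pair.lnest_at_critical[OF swapped_critical_pair] lnest_at_critical values_differ
  unfolding swapped_i swapped_m by (auto simp: of_bool_def)

section \<open>Upper arcs, cycle peaks and parity bounds under the exchange\<close>

lemma swapped_upper_iff: "k < swapped k \<longleftrightarrow> k < \<sigma> k"
  using swapped_i swapped_m swapped_other[of k] i_less_m lower_i lower_m
  by (cases "k = i"; cases "k = m") auto

lemma swapped_lower_iff: "swapped k < k \<longleftrightarrow> \<sigma> k < k"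
  using swapped_i swapped_m swapped_other[of k] i_less_m lower_i lower_m
  by (cases "k = i"; cases "k = m") auto

lemma swapped_upper: "k < \<sigma> k \<Longrightarrow> swapped k = \<sigma> k"
  using i_less_m lower_i lower_m swapped_other[of k] by (cases "k = i"; cases "k = m") auto

lemma swapped_upper': "k < swapped k \<Longrightarrow> swapped k = \<sigma> k"
  using swapped_upper swapped_upper_iff by blast

text \<open>The inequalities force both \<open>j\<close> and \<open>k\<close> to emit upper arcs,
  while \<open>i\<close> and \<open>m\<close> emit lower arcs before and after the exchange.\<close>

lemma ucross_at_swapped: "ucross_at N k swapped = ucross_at N k \<sigma>"
proof -
  have "j < k \<and> k < swapped j \<and> swapped j < swapped k \<longleftrightarrow> j < k \<and> k < \<sigma> j \<and> \<sigma> j < \<sigma> k" for j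
    using swapped_upper[of j] swapped_upper[of k] swapped_upper'[of j] swapped_upper'[of k]
    by (smt (verit) less_trans)
  then show ?thesis by (simp only: ucross_at_def)
qed

lemma unest_at_swapped: "unest_at N k swapped = unest_at N k \<sigma>"
proof -
  have "j < k \<and> k < swapped k \<and> swapped k < swapped j \<longleftrightarrow> j < k \<and> k < \<sigma> k \<and> \<sigma> k < \<sigma> j" for j
    using swapped_upper[of j] swapped_upper[of k] swapped_upper'[of j] swapped_upper'[of k]
    by (smt (verit) less_trans)
  then show ?thesis by (simp only: unest_at_def)
qed

lemma inv_swapped: "inv swapped = transpose i m \<circ> inv \<sigma>"
  using o_inv_distrib[OF permutes_bij[OF perm] bij_transpose] by simp

text \<open>Only the values \<open>\<sigma> i\<close> and \<open>\<sigma> m\<close> get new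
  preimages, and both \<open>i\<close> and \<open>m\<close> exceed both values.\<close>

lemma cycle_peaks_swapped: "cycle_peaks N swapped = cycle_peaks N \<sigma>"
proof -
  have "inv swapped k < k \<longleftrightarrow> inv \<sigma> k < k" for k
  proof -
    have "\<sigma> (inv \<sigma> k) = k" using permutes_inverses(1)[OF perm] .
    then show ?thesis unfolding inv_swapped o_apply
      using lower_i lower_m i_less_m
      by (cases "inv \<sigma> k = i"; cases "inv \<sigma> k = m") (auto simp: transpose_def)
  qed
  then show ?thesis unfolding cycle_peaks_def swapped_lower_iff by simp
qed

text \<open>This puts the one term that changes into the sums over cycle peaks. A preimage of
  \<open>i\<close> above \<open>i\<close> would, together with \<open>m\<close>, violate thinness
  beyond \<open>i\<close>.\<close>

lemma i_cycle_peak: "i \<in> cycle_peaks N \<sigma>"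
proof -
  have s: "\<sigma> (inv \<sigma> i) = i" using permutes_inverses(1)[OF perm] .
  have "inv \<sigma> i < i"
  proof (rule ccontr)
    assume "\<not> inv \<sigma> i < i"
    moreover have "inv \<sigma> i \<noteq> i" "inv \<sigma> i \<noteq> m" using s lower_i lower_m by auto
    ultimately have gt: "i < inv \<sigma> i" by simp
    consider "inv \<sigma> i < m" | "m < inv \<sigma> i" using \<open>inv \<sigma> i \<noteq> m\<close> by linarith
    then show False
      using last[of "inv \<sigma> i" m] last[of m "inv \<sigma> i"] s gt lower_m i_less_m by cases auto
  qed
  then show ?thesis using i_in lower_i by (simp add: cycle_peaks_def)
qed

lemma swapped_not_lower_thin: "\<not> lower_thin swapped"
  unfolding lower_thin_def using swapped_i swapped_m lower_i lower_m i_less_m by (metis not_le)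

lemma swapped_D_perms:
  assumes "\<sigma> \<in> D_perms n"
  shows "swapped \<in> D_perms n"
proof -
  have N: "\<sigma> permutes {1..2*n}" and par: "\<And>k. k \<in> {1..2*n} \<Longrightarrow> parity_bound \<sigma> k"
    using assms by (auto simp: D_perms_iff)
  \<comment> \<open>The locale has an arbitrary \<open>N\<close>, so the pair is restated at the
    size given by the assumption.\<close>
  interpret D: critical_pair "2*n" \<sigma> i m
    using N i_less_m lower_i lower_m last by unfold_locales
  have "parity_bound swapped k" if "k \<in> {1..2*n}" for k
    using par[OF that] swapped_lower_iff[of k] swapped_upper_iff[of k]
    by (auto simp: parity_bound_def not_less[symmetric] split: if_splits simp del: o_apply)
  then show ?thesis using D.swapped_permutes by (simp add: D_perms_iff)
qed

text \<open>Terms away from \<open>i\<close> occur twice and cancel modulo 2; the two terms at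
  \<open>i\<close> add up to 1.\<close>

lemma odd_sum_swap:
  assumes "finite P" "i \<in> P" "\<And>k. k \<noteq> i \<Longrightarrow> f k = g k" "f i + g i = (1::nat)"
  shows "odd (sum f P + sum g P)"
proof -
  have "sum f P + sum g P = (f i + g i) + (sum f (P - {i}) + sum g (P - {i}))"
    using assms(1,2) by (simp add: sum.remove)
  also have "sum f (P - {i}) = sum g (P - {i})" using assms(3) by (intro sum.cong) auto
  finally show ?thesis by (simp add: assms(4))
qed

end

section \<open>Uniqueness and existence of the critical pair, and the cancellation\<close>

lemma critical_pair_unique:
  assumes "critical_pair N \<sigma> i m" "critical_pair N \<sigma> i' m'"
  shows "i = i' \<and> m = m'"
proof -
  interpret a: critical_pair N \<sigma> i m by fact
  interpret b: critical_pair N \<sigma> i' m' by fact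
  have "i = i'"
    using a.last[of i' m'] b.last[of i m] a.lower_i b.lower_i a.lower_m b.lower_m a.i_less_m b.i_less_m
    by (metis linorder_cases not_le)
  then show ?thesis using b.partner_unique[of m] a.i_less_m a.lower_m by simp
qed

lemma critical_pair_exists:
  assumes "\<sigma> permutes {1..N}" "\<not> lower_thin \<sigma>"
  shows "\<exists>i m. critical_pair N \<sigma> i m"
proof -
  \<comment> \<open>The points where thinness fails. They are moved by \<open>\<sigma>\<close>, so
    they lie in \<open>{1..N}\<close> and have a maximum; maximality gives the locale assumption
    \<open>last\<close>.\<close>
  define V where "V = {k. \<sigma> k < k \<and> (\<exists>j>k. \<sigma> j < k)}"
  have "V \<subseteq> {1..N}"
  proof
    fix k assume "k \<in> V"
    then have "\<sigma> k \<noteq> k" by (simp add: V_def)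
    then show "k \<in> {1..N}" using permutes_not_in[OF assms(1)] by blast
  qed
  then have fin: "finite V" by (rule finite_subset) simp
  have "V \<noteq> {}" using assms(2) by (auto simp: V_def lower_thin_def not_le)
  then have "Max V \<in> V" using fin by simp
  then obtain m where "\<sigma> (Max V) < Max V" "Max V < m" "\<sigma> m < Max V" by (auto simp: V_def)
  moreover have "k \<le> \<sigma> j" if "Max V < k" "k < j" "\<sigma> k < k" for k j
  proof (rule ccontr)
    assume "\<not> k \<le> \<sigma> j"
    then have "k \<in> V" using that by (auto simp: V_def)
    then show False using Max_ge[OF fin, of k] that(1) by simp
  qed
  ultimately have "critical_pair N \<sigma> (Max V) m" using assms(1) by unfold_locales
  then show ?thesis by blast
qed

text \<open>Uniqueness of the critical pair makes the exchange a function of the permutation alone,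
  as reindexing a sum requires; on lower-thin permutations the description denotes nothing.\<close>

definition critical_flip :: "nat \<Rightarrow> (nat \<Rightarrow> nat) \<Rightarrow> nat \<Rightarrow> nat" where
  "critical_flip N \<sigma> = (THE \<tau>. \<exists>i m. critical_pair N \<sigma> i m \<and> \<tau> = \<sigma> \<circ> transpose i m)"

lemma critical_flip_eq:
  assumes "critical_pair N \<sigma> i m"
  shows "critical_flip N \<sigma> = \<sigma> \<circ> transpose i m"
  unfolding critical_flip_def
  by (rule the_equality) (use assms critical_pair_unique[OF assms] in blast)+

lemma signed_sum_D_perms:
  fixes st :: "(nat \<Rightarrow> nat) \<Rightarrow> nat"
  assumes swap: "\<And>\<sigma> i m. critical_pair (2*n) \<sigma> i m \<Longrightarrow> odd (st \<sigma> + st (\<sigma> \<circ> transpose i m))"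
    and thin: "\<And>\<sigma>. \<sigma> permutes {1..2*n} \<Longrightarrow> lower_thin \<sigma> \<Longrightarrow> st \<sigma> = 0"
  shows "(\<Sum>\<sigma>\<in>D_perms n. (-1) ^ st \<sigma>) = (2 ^ n * fib_odd n :: int)"
proof -
  let ?B = "{\<sigma> \<in> D_perms n. \<not> lower_thin \<sigma>}"
  let ?f = "\<lambda>\<sigma>. (-1) ^ st \<sigma> :: int"
  let ?c = "critical_flip (2*n)"
  have flip: "?c \<sigma> \<in> ?B \<and> ?c (?c \<sigma>) = \<sigma> \<and> ?f (?c \<sigma>) = - ?f \<sigma>" if "\<sigma> \<in> ?B" for \<sigma>
  proof -
    obtain i m where c: "critical_pair (2*n) \<sigma> i m"
      using critical_pair_exists[of \<sigma> "2*n"] \<open>\<sigma> \<in> ?B\<close> by (auto simp: D_perms_iff)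
    interpret critical_pair "2*n" \<sigma> i m by fact
    have e: "?c \<sigma> = \<sigma> \<circ> transpose i m" by (rule critical_flip_eq[OF c])
    have "?c (?c \<sigma>) = \<sigma>"
      unfolding e critical_flip_eq[OF swapped_critical_pair] by (rule swapped_swapped)
    moreover have "?f (?c \<sigma>) = - ?f \<sigma>"
      unfolding e using swap[OF c] by (cases "even (st \<sigma>)") (simp_all del: o_apply)
    moreover have "?c \<sigma> \<in> ?B"
      unfolding e using swapped_D_perms swapped_not_lower_thin \<open>\<sigma> \<in> ?B\<close> by blast
    ultimately show ?thesis by blast
  qed
  have "bij_betw ?c ?B ?B"
    by (rule bij_betw_byWitness[where f' = ?c]) (use flip in auto)
  then have "sum ?f ?B = (\<Sum>\<sigma>\<in>?B. ?f (?c \<sigma>))" by (rule sum.reindex_bij_betw[symmetric])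
  \<comment> \<open>Reindexing by a sign-reversing involution shows that the sum is its own
    negative.\<close>
  also have "\<dots> = - sum ?f ?B" using flip by (simp add: sum_negf[symmetric])
  finally have B0: "sum ?f ?B = 0" by simp
  have A: "{\<sigma> \<in> D_perms n. lower_thin \<sigma>} = thin_closed (2*n)"
    by (auto simp: D_perms_iff thin_closed_def)
  have "D_perms n = thin_closed (2*n) \<union> ?B" unfolding A[symmetric] by blast
  then have "sum ?f (D_perms n) = sum ?f (thin_closed (2*n) \<union> ?B)" by simp
  also have "\<dots> = sum ?f (thin_closed (2*n)) + sum ?f ?B"
    by (rule sum.union_disjoint)
      (simp_all add: finite_thin_closed finite_D_perms, auto simp: thin_closed_def)
  also have "sum ?f (thin_closed (2*n)) = int (card (thin_closed (2*n)))"
    using thin by (simp add: thin_closed_def)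
  finally show ?thesis using B0 card_thin(1) by simp
qed

section \<open>Signed enumeration by lower statistics\<close>

definition nrc_total :: "nat \<Rightarrow> (nat \<Rightarrow> nat) \<Rightarrow> nat" where
  "nrc_total N \<sigma> = nrcpeak N \<sigma> + nrcval N \<sigma> + nrcdrise N \<sigma> + nrcdfall N \<sigma>"

text \<open>This is the generating polynomial of the statistic evaluated at -1, by
  \<open>poly_stat_poly\<close>.\<close>

definition signed_count :: "(nat \<Rightarrow> (nat \<Rightarrow> nat) \<Rightarrow> nat) \<Rightarrow> nat \<Rightarrow> int" where
  "signed_count st n = (\<Sum>\<sigma>\<in>D_perms n. (-1) ^ st (2*n) \<sigma>)"

section \<open>Parity change of each lower or total statistic\<close>

context critical_pair
begin

lemma lnest_at_critical_indicator_sum: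
  "of_bool (lnest_at N i \<sigma> \<noteq> 0) + of_bool (lnest_at N i swapped \<noteq> 0) = (1::nat)"
  using lnest_at_critical_sum by (cases "lnest_at N i \<sigma>") auto

lemma odd_lcross: "odd (lcross N \<sigma> + lcross N swapped)"
  unfolding lcross_def
  by (rule odd_sum_swap) (use i_in lcross_at_swapped lcross_at_critical_sum in auto)

lemma odd_lnest: "odd (lnest N \<sigma> + lnest N swapped)"
  unfolding lnest_def
  by (rule odd_sum_swap) (use i_in lnest_at_swapped lnest_at_critical_sum in auto)

lemma odd_lcrosscpeak: "odd (lcrosscpeak N \<sigma> + lcrosscpeak N swapped)"
  unfolding lcrosscpeak_def cycle_peaks_swapped
  by (rule odd_sum_swap) (use i_cycle_peak lcross_at_swapped lcross_at_critical_sum in auto)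

lemma odd_lnestcpeak: "odd (lnestcpeak N \<sigma> + lnestcpeak N swapped)"
  unfolding lnestcpeak_def cycle_peaks_swapped
  by (rule odd_sum_swap) (use i_cycle_peak lnest_at_swapped lnest_at_critical_sum in auto)

lemma odd_nrcpeak: "odd (nrcpeak N \<sigma> + nrcpeak N swapped)"
  unfolding nrcpeak_eq_sum[OF perm] nrcpeak_eq_sum[OF swapped_permutes] cycle_peaks_swapped
  by (rule odd_sum_swap)
    (use i_cycle_peak lnest_at_swapped lnest_at_critical_indicator_sum in \<open>simp_all del: o_apply\<close>)

text \<open>The indicators of upper nestings are unchanged, so they contribute twice the same
  amount; the odd part comes from the lower ones.\<close>

lemma odd_nrc_total: "odd (nrc_total N \<sigma> + nrc_total N swapped)"
proof -
  have "odd ((\<Sum>k\<in>{1..N}. of_bool (lnest_at N k \<sigma> \<noteq> 0) :: nat) +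
      (\<Sum>k\<in>{1..N}. of_bool (lnest_at N k swapped \<noteq> 0)))"
    by (rule odd_sum_swap)
      (use i_in lnest_at_swapped lnest_at_critical_indicator_sum in \<open>simp_all del: o_apply\<close>)
  then show ?thesis
    unfolding nrc_total_def nrc_total_eq_sum[OF perm] nrc_total_eq_sum[OF swapped_permutes]
      unest_at_swapped by presburger
qed

lemma odd_cross: "odd (ucross N \<sigma> + lcross N \<sigma> + (ucross N swapped + lcross N swapped))"
  using odd_lcross by (simp add: ucross_def ucross_at_swapped del: o_apply)

lemma odd_nest: "odd (unest N \<sigma> + lnest N \<sigma> + (unest N swapped + lnest N swapped))"
  using odd_lnest by (simp add: unest_def unest_at_swapped del: o_apply)

end

lemma signed_count_lower:
  shows signed_count_nrcpeak: "signed_count nrcpeak n = 2 ^ n * fib_odd n"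
    and signed_count_nrc_total: "signed_count nrc_total n = 2 ^ n * fib_odd n"
    and signed_count_lcrosscpeak: "signed_count lcrosscpeak n = 2 ^ n * fib_odd n"
    and signed_count_lnestcpeak: "signed_count lnestcpeak n = 2 ^ n * fib_odd n"
    and signed_count_lcross: "signed_count lcross n = 2 ^ n * fib_odd n"
    and signed_count_lnest: "signed_count lnest n = 2 ^ n * fib_odd n"
    and signed_count_cross: "signed_count (\<lambda>N \<sigma>. ucross N \<sigma> + lcross N \<sigma>) n = 2 ^ n * fib_odd n"
    and signed_count_nest: "signed_count (\<lambda>N \<sigma>. unest N \<sigma> + lnest N \<sigma>) n = 2 ^ n * fib_odd n"
  unfolding signed_count_def
  \<comment> \<open>Each round treats one statistic and discharges the two premises in turn: parity
    change under the exchange, then vanishing on lower-thin permutations.\<close>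
  by (rule signed_sum_D_perms,
      erule critical_pair.odd_nrcpeak critical_pair.odd_nrc_total critical_pair.odd_lcrosscpeak
        critical_pair.odd_lnestcpeak critical_pair.odd_lcross critical_pair.odd_lnest
        critical_pair.odd_cross critical_pair.odd_nest,
      simp add: nrcpeak_eq_sum nrc_total_eq_sum[folded nrc_total_def] lcrosscpeak_def lnestcpeak_def
        lcross_def lnest_def ucross_def unest_def lower_thin_lcross_at lower_thin_lnest_at
        lower_thin_ucross_at lower_thin_unest_at)+

section \<open>Reverse-complement\<close>

text \<open>The identity branch outside \<open>{1..N}\<close> makes this a permutation in the sense
  of \<open>permutes\<close>, so conjugation by it keeps permutations of
  \<open>{1..N}\<close>.\<close>

definition reflect :: "nat \<Rightarrow> nat \<Rightarrow> nat" where
  "reflect N k = (if k \<in> {1..N} then Suc N - k else k)"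

definition rev_compl :: "nat \<Rightarrow> (nat \<Rightarrow> nat) \<Rightarrow> nat \<Rightarrow> nat" where
  "rev_compl N \<sigma> = reflect N \<circ> \<sigma> \<circ> reflect N"

lemma reflect_reflect [simp]: "reflect N (reflect N k) = k"
  by (auto simp: reflect_def)

lemma reflect_in_iff [simp]: "reflect N k \<in> {1..N} \<longleftrightarrow> k \<in> {1..N}"
  by (auto simp: reflect_def)

lemma reflect_less_iff: "j \<in> {1..N} \<Longrightarrow> k \<in> {1..N} \<Longrightarrow> reflect N j < reflect N k \<longleftrightarrow> k < j"
  by (auto simp: reflect_def)

lemma reflect_permutes: "reflect N permutes {1..N}"
proof (rule bij_imp_permutes)
  show "bij_betw (reflect N) {1..N} {1..N}"
    by (rule bij_betw_byWitness[where f' = "reflect N"])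
      (simp_all add: image_subset_iff del: atLeastAtMost_iff One_nat_def)
qed (auto simp: reflect_def)

lemma rev_compl_reflect [simp]: "rev_compl N \<sigma> (reflect N k) = reflect N (\<sigma> k)"
  by (simp add: rev_compl_def)

lemma rev_compl_rev_compl: "rev_compl N (rev_compl N \<sigma>) = \<sigma>"
  by (rule ext) (simp add: rev_compl_def)

lemma rev_compl_permutes: "\<sigma> permutes {1..N} \<Longrightarrow> rev_compl N \<sigma> permutes {1..N}"
  unfolding rev_compl_def by (intro permutes_compose reflect_permutes)

lemma inv_rev_compl:
  assumes "\<sigma> permutes {1..N}"
  shows "inv (rev_compl N \<sigma>) (reflect N k) = reflect N (inv \<sigma> k)"
  using permutes_inverses(1)[OF assms, of k]
  by (simp add: permutes_inv_eq[OF rev_compl_permutes[OF assms]])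

text \<open>Since \<open>2*n\<close> is even, reflection changes the parity of a point and reverses
  the order, so the bounds at odd and even points turn into each other.\<close>

lemma rev_compl_D_perms:
  assumes "\<sigma> \<in> D_perms n"
  shows "rev_compl (2*n) \<sigma> \<in> D_perms n"
proof -
  have p: "\<sigma> permutes {1..2*n}" and par: "\<And>k. k \<in> {1..2*n} \<Longrightarrow> parity_bound \<sigma> k"
    using assms by (auto simp: D_perms_iff)
  have "parity_bound (rev_compl (2*n) \<sigma>) k" if k: "k \<in> {1..2*n}" for k
  proof -
    define l where "l = reflect (2*n) k"
    have kl: "k = reflect (2*n) l" and l: "l \<in> {1..2*n}" using k by (simp_all add: l_def del: atLeastAtMost_iff One_nat_def)
    have sl: "\<sigma> l \<in> {1..2*n}" using permutes_in_image[OF p] l by blast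
    have "odd k \<longleftrightarrow> even l" using k by (auto simp: l_def reflect_def)
    then show ?thesis
      using par[OF l] reflect_less_iff[OF l sl] reflect_less_iff[OF sl l]
      unfolding parity_bound_def kl rev_compl_reflect by (auto simp: not_less[symmetric])
  qed
  then show ?thesis using rev_compl_permutes[OF p] by (simp add: D_perms_iff)
qed

section \<open>Transport of the statistics along reverse-complement\<close>

lemma card_filter_reflect: "card {j \<in> {1..N}. P (reflect N j)} = card {j \<in> {1..N}. P j}"
proof -
  have "bij_betw (reflect N) {j \<in> {1..N}. P (reflect N j)} {j \<in> {1..N}. P j}"
    by (rule bij_betw_byWitness[where f' = "reflect N"])
      (auto simp: image_subset_iff simp del: atLeastAtMost_iff One_nat_def)
  then show ?thesis by (rule bij_betw_same_card)
qed

text \<open>Positions and values are reflected together, so every inequality in the chain defining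
  an upper crossing is reversed.\<close>

lemma ucross_at_eq_lcross_at:
  assumes "\<sigma> permutes {1..N}" "k \<in> {1..N}"
  shows "ucross_at N k \<sigma> = lcross_at N (reflect N k) (rev_compl N \<sigma>)"
proof -
  have s: "\<sigma> j \<in> {1..N} \<longleftrightarrow> j \<in> {1..N}" for j using permutes_in_image[OF assms(1)] .
  have "{j \<in> {1..N}. j < k \<and> k < \<sigma> j \<and> \<sigma> j < \<sigma> k} =
    {j \<in> {1..N}. reflect N j > reflect N k \<and> reflect N k > rev_compl N \<sigma> (reflect N j)
      \<and> rev_compl N \<sigma> (reflect N j) > rev_compl N \<sigma> (reflect N k)}"
    by (rule Collect_cong)
      (simp add: reflect_less_iff assms(2) s del: atLeastAtMost_iff One_nat_def cong: conj_cong)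
  then show ?thesis
    using card_filter_reflect[of N "\<lambda>j. j > reflect N k \<and> reflect N k > rev_compl N \<sigma> j
      \<and> rev_compl N \<sigma> j > rev_compl N \<sigma> (reflect N k)"]
    by (simp only: ucross_at_def lcross_at_def)
qed

lemma unest_at_eq_lnest_at:
  assumes "\<sigma> permutes {1..N}" "k \<in> {1..N}"
  shows "unest_at N k \<sigma> = lnest_at N (reflect N k) (rev_compl N \<sigma>)"
proof -
  have s: "\<sigma> j \<in> {1..N} \<longleftrightarrow> j \<in> {1..N}" for j using permutes_in_image[OF assms(1)] .
  have "{j \<in> {1..N}. j < k \<and> k < \<sigma> k \<and> \<sigma> k < \<sigma> j} =
    {j \<in> {1..N}. reflect N j > reflect N k \<and> reflect N k > rev_compl N \<sigma> (reflect N k)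
      \<and> rev_compl N \<sigma> (reflect N k) > rev_compl N \<sigma> (reflect N j)}"
    by (rule Collect_cong)
      (simp add: reflect_less_iff assms(2) s del: atLeastAtMost_iff One_nat_def cong: conj_cong)
  then show ?thesis
    using card_filter_reflect[of N "\<lambda>j. j > reflect N k \<and> reflect N k > rev_compl N \<sigma> (reflect N k)
      \<and> rev_compl N \<sigma> (reflect N k) > rev_compl N \<sigma> j"]
    by (simp only: unest_at_def lnest_at_def)
qed

text \<open>Conjugation commutes with inversion, so a point, its image and its preimage are all
  reflected and both inequalities turn round.\<close>

lemma bij_betw_valleys_peaks:
  assumes "\<sigma> permutes {1..N}"
  shows "bij_betw (reflect N) (cycle_valleys N \<sigma>) (cycle_peaks N (rev_compl N \<sigma>))"
proof -
  have iff: "k \<in> cycle_valleys N \<sigma> \<longleftrightarrow> reflect N k \<in> cycle_peaks N (rev_compl N \<sigma>)" for k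
    using permutes_in_image[OF assms, of k] permutes_in_image[OF permutes_inv[OF assms], of k]
    unfolding cycle_valleys_def cycle_peaks_def mem_Collect_eq inv_rev_compl[OF assms] rev_compl_reflect
    by (simp add: reflect_less_iff del: atLeastAtMost_iff One_nat_def cong: conj_cong)
  show ?thesis
    by (rule bij_betw_byWitness[where f' = "reflect N"]) (auto simp: iff)
qed

lemma bij_betw_reflect: "bij_betw (reflect N) {1..N} {1..N}"
  by (rule permutes_imp_bij[OF reflect_permutes])

lemma valley_in: "k \<in> cycle_valleys N \<sigma> \<Longrightarrow> k \<in> {1..N}"
  by (simp add: cycle_valleys_def)

lemma rev_compl_statistics:
  assumes "\<sigma> permutes {1..N}"
  shows "nrcval N \<sigma> = nrcpeak N (rev_compl N \<sigma>)"
    and "ucrosscval N \<sigma> = lcrosscpeak N (rev_compl N \<sigma>)"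
    and "unestcval N \<sigma> = lnestcpeak N (rev_compl N \<sigma>)"
    and "ucross N \<sigma> = lcross N (rev_compl N \<sigma>)"
    and "unest N \<sigma> = lnest N (rev_compl N \<sigma>)"
proof -
  note valley = sum.reindex_bij_betw[OF bij_betw_valleys_peaks[OF assms], symmetric]
  note all = sum.reindex_bij_betw[OF bij_betw_reflect, of _ N, symmetric]
  note at = ucross_at_eq_lcross_at[OF assms] unest_at_eq_lnest_at[OF assms]
  show "nrcval N \<sigma> = nrcpeak N (rev_compl N \<sigma>)"
    unfolding nrcval_eq_sum[OF assms] nrcpeak_eq_sum[OF rev_compl_permutes[OF assms]] valley
    by (rule sum.cong) (simp_all only: at valley_in)
  show "ucrosscval N \<sigma> = lcrosscpeak N (rev_compl N \<sigma>)"
    unfolding ucrosscval_def lcrosscpeak_def valley by (rule sum.cong) (simp_all only: at valley_in)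
  show "unestcval N \<sigma> = lnestcpeak N (rev_compl N \<sigma>)"
    unfolding unestcval_def lnestcpeak_def valley by (rule sum.cong) (simp_all only: at valley_in)
  show "ucross N \<sigma> = lcross N (rev_compl N \<sigma>)"
    unfolding ucross_def lcross_def all[of "\<lambda>k. lcross_at N k (rev_compl N \<sigma>)"]
    by (rule sum.cong) (simp_all only: at)
  show "unest N \<sigma> = lnest N (rev_compl N \<sigma>)"
    unfolding unest_def lnest_def all[of "\<lambda>k. lnest_at N k (rev_compl N \<sigma>)"]
    by (rule sum.cong) (simp_all only: at)
qed

text \<open>Reverse-complement is an involution of \<open>D_perms n\<close>, hence may be used to
  reindex the sum.\<close>

lemma signed_count_rev_compl:
  assumes "\<And>\<sigma>. \<sigma> permutes {1..2*n} \<Longrightarrow> st (2*n) \<sigma> = st' (2*n) (rev_compl (2*n) \<sigma>)"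
  shows "signed_count st n = signed_count st' n"
proof -
  have "bij_betw (rev_compl (2*n)) (D_perms n) (D_perms n)"
    by (rule bij_betw_byWitness[where f' = "rev_compl (2*n)"])
      (auto simp: rev_compl_rev_compl rev_compl_D_perms)
  then show ?thesis
    unfolding signed_count_def
    by (subst sum.reindex_bij_betw[symmetric]) (auto intro!: sum.cong simp: assms D_perms_iff)
qed

lemma signed_count_upper:
  shows signed_count_nrcval: "signed_count nrcval n = 2 ^ n * fib_odd n"
    and signed_count_ucrosscval: "signed_count ucrosscval n = 2 ^ n * fib_odd n"
    and signed_count_unestcval: "signed_count unestcval n = 2 ^ n * fib_odd n"
    and signed_count_ucross: "signed_count ucross n = 2 ^ n * fib_odd n"
    and signed_count_unest: "signed_count unest n = 2 ^ n * fib_odd n"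
  using rev_compl_statistics signed_count_rev_compl[where st' = nrcpeak]
    signed_count_rev_compl[where st' = lcrosscpeak] signed_count_rev_compl[where st' = lnestcpeak]
    signed_count_rev_compl[where st' = lcross] signed_count_rev_compl[where st' = lnest]
  by (metis signed_count_lower)+

section \<open>Cyclic sieving\<close>

lemma poly_stat_poly: "poly (stat_poly X st) x = (\<Sum>y\<in>X. x ^ st y)"
  by (simp add: stat_poly_def poly_sum poly_monom)

text \<open>At 1 the polynomial of any statistic counts the set, and the number of fixed points is
  prescribed to be \<open>a n\<close>; only the value at -1 remains.\<close>

lemma stat_exhibits_CSP_if_signed_count:
  assumes "\<And>n. signed_count st n = a n"
  shows "stat_exhibits_CSP st a"
  using assms unfolding stat_exhibits_CSP_def exhibits_CSP_def poly_stat_poly signed_count_def by simp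

theorem theorem6p6:
  fixes a :: "nat \<Rightarrow> int"
  defines "a \<equiv> (\<lambda>n. 2 ^ n * fib_odd n)"
  shows "stat_exhibits_CSP nrcpeak a
    \<and> stat_exhibits_CSP nrcval a
    \<and> stat_exhibits_CSP
        (\<lambda>N \<sigma>. nrcpeak N \<sigma> + nrcval N \<sigma> + nrcdrise N \<sigma> + nrcdfall N \<sigma>) a
    \<and> stat_exhibits_CSP lcrosscpeak a
    \<and> stat_exhibits_CSP lnestcpeak a
    \<and> stat_exhibits_CSP ucrosscval a
    \<and> stat_exhibits_CSP unestcval a
    \<and> stat_exhibits_CSP lcross a
    \<and> stat_exhibits_CSP lnest a
    \<and> stat_exhibits_CSP ucross a
    \<and> stat_exhibits_CSP unest a
    \<and> stat_exhibits_CSP (\<lambda>N \<sigma>. ucross N \<sigma> + lcross N \<sigma>) a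
    \<and> stat_exhibits_CSP (\<lambda>N \<sigma>. unest N \<sigma> + lnest N \<sigma>) a"
proof -
  have nrc: "(\<lambda>N \<sigma>. nrcpeak N \<sigma> + nrcval N \<sigma> + nrcdrise N \<sigma> + nrcdfall N \<sigma>) = nrc_total"
    by (intro ext) (simp add: nrc_total_def)
  show ?thesis
    unfolding nrc
    by (intro conjI stat_exhibits_CSP_if_signed_count)
      (simp_all add: a_def signed_count_lower signed_count_upper)
qed

end
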